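(* Let $a$ satisfy assumption (a) of the context and let $f$ be a bounded function in $\Omega\times[0,T]$ with $\operatorname{supp} f(\cdot,t)\subset\Omega$ for all $t\in[0,T]$. Then the volume potential $$(Vf)(x,t)=\int_0^t\int_\Omega\varepsilon_{n,a}(x-\xi,b(t,\tau))f(\xi,\tau)\,d\xi\,d\tau,\qquad x\in\Omega,\ 0<t<T,$$ admits the estimate $$|(Vf)(x,t)|\le t\sup_{(\xi,\tau)\in\Omega\times[0,t]}|f(\xi,\tau)|,\qquad x\in\Omega,\ 0<t<T,$$ and $u=Vf$ solves the equation $\frac{\partial u}{\partial t}-a(t)\Delta_x u=f$ in $\Omega\times(0,T)$ with the zero initial condition $u(\cdot,t)\to0$ as $t\to0+$ in $\Omega$.
   Context: Setting: $0<T<\infty$, $n\ge 2$, $\Omega\subset\mathbb{R}^n$ is a bounded domain with boundary $\partial\Omega\in C^{1+\lambda}$, $0<\lambda<1$. The coefficient $a\in L_1[0,T]$ is defined on $[0,T]$. Assumption (a): $a(t)$ is nonnegative and becomes zero only at isolated points. Notation: $a_1(t)=\int_0^t a(z)\,dz$, $b(t,\tau)=\int_\tau^t a(z)\,dz=a_1(t)-a_1(\tau)$, $\varepsilon_n(x,t)=\theta(t)(4\pi t)^{-n/2}e^{-|x|^2/(4t)}$ is the fundamental solution of the standard heat operator ($\theta$ is the Heaviside function), and $\varepsilon_{n,a}(x-\xi,b(t,\tau)):=\varepsilon_n(x-\xi,a_1(t)-a_1(\tau))$. *)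

theory Defs
  imports "HOL-Analysis.Analysis"
begin

section \<open>Domains of class $C^{1+\lambda}$\<close>

text \<open>Regularity of real functions on an open set: the gradient exists and is
  Hoelder continuous with exponent \<open>l\<close>.\<close>

definition holder_C1_on :: "real \<Rightarrow> 'a::euclidean_space set \<Rightarrow> ('a \<Rightarrow> real) \<Rightarrow> bool" where
  "holder_C1_on l U g \<longleftrightarrow>
     (\<exists>G. (\<forall>x\<in>U. (g has_derivative (\<lambda>h. G x \<bullet> h)) (at x)) \<and>
          (\<exists>C. \<forall>x\<in>U. \<forall>y\<in>U. norm (G x - G y) \<le> C * dist x y powr l))"

text \<open>Near each boundary point \<open>p\<close> the domain is, in a rotated coordinate system whose last axis
  points in the direction \<open>e\<close>, the region above the graph of a \<open>C\<^sup>1\<close> function with Hoelder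
  continuous gradient. A function of the remaining \<open>n - 1\<close> coordinates is encoded as a function
  \<open>g\<close> on the whole space that is constant in the direction \<open>e\<close>.\<close>

definition C1_holder_domain :: "real \<Rightarrow> 'a::euclidean_space set \<Rightarrow> bool" where
  "C1_holder_domain l \<Omega> \<longleftrightarrow>
     open \<Omega> \<and> connected \<Omega> \<and> \<Omega> \<noteq> {} \<and> bounded \<Omega> \<and>
     (\<forall>p\<in>frontier \<Omega>. \<exists>e r g. norm e = 1 \<and> r > 0 \<and>
        (\<forall>x s. g (x + s *\<^sub>R e) = g x) \<and>
        holder_C1_on l (ball p r) g \<and>
        \<Omega> \<inter> ball p r = {x \<in> ball p r. x \<bullet> e > g x})"

section \<open>Fundamental solution and volume potential\<close>

definition heat_kernel :: "real ^ 'n \<Rightarrow> real \<Rightarrow> real" where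
  "heat_kernel x t =
     (if t > 0 then (4 * pi * t) powr (- real CARD('n) / 2) * exp (- (norm x)\<^sup>2 / (4 * t)) else 0)"

definition a1 :: "(real \<Rightarrow> real) \<Rightarrow> real \<Rightarrow> real" where
  "a1 a t = (LINT z:{0..t}|lebesgue. a z)"

definition volume_potential ::
    "(real ^ 'n) set \<Rightarrow> (real \<Rightarrow> real) \<Rightarrow> ((real ^ 'n) \<times> real \<Rightarrow> real) \<Rightarrow> (real ^ 'n) \<times> real \<Rightarrow> real" where
  "volume_potential \<Omega> a f = (\<lambda>(x, t).
     LINT \<tau>:{0..t}|lebesgue. (LINT \<xi>:\<Omega>|lebesgue.
       heat_kernel (x - \<xi>) (a1 a t - a1 a \<tau>) * f (\<xi>, \<tau>)))"

section \<open>Test functions\<close>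

definition dderiv :: "'b::euclidean_space \<Rightarrow> ('b \<Rightarrow> real) \<Rightarrow> 'b \<Rightarrow> real" where
  "dderiv v \<phi> p = frechet_derivative \<phi> (at p) v"

fun k_smooth :: "nat \<Rightarrow> ('b::euclidean_space \<Rightarrow> real) \<Rightarrow> bool" where
  "k_smooth 0 \<phi> \<longleftrightarrow> continuous_on UNIV \<phi>"
| "k_smooth (Suc k) \<phi> \<longleftrightarrow> (\<forall>p. \<phi> differentiable (at p)) \<and> (\<forall>v. k_smooth k (dderiv v \<phi>))"

definition test_function :: "'b::euclidean_space set \<Rightarrow> ('b \<Rightarrow> real) \<Rightarrow> bool" where
  "test_function U \<phi> \<longleftrightarrow>
     (\<forall>k. k_smooth k \<phi>) \<and>
     compact (closure (support_on UNIV \<phi>)) \<and> closure (support_on UNIV \<phi>) \<subseteq> U"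

definition time_deriv :: "((real ^ 'n) \<times> real \<Rightarrow> real) \<Rightarrow> (real ^ 'n) \<times> real \<Rightarrow> real" where
  "time_deriv \<phi> = dderiv (0, 1) \<phi>"

definition space_laplacian :: "((real ^ 'n) \<times> real \<Rightarrow> real) \<Rightarrow> (real ^ 'n) \<times> real \<Rightarrow> real" where
  "space_laplacian \<phi> p = (\<Sum>i\<in>UNIV. dderiv (axis i 1, 0) (dderiv (axis i 1, 0) \<phi>) p)"

section \<open>The degenerate heat equation\<close>

definition locally_integrable_on ::
    "'b::euclidean_space set \<Rightarrow> ('b \<Rightarrow> real) \<Rightarrow> bool" where
  "locally_integrable_on U u \<longleftrightarrow> (\<forall>K. compact K \<and> K \<subseteq> U \<longrightarrow> set_integrable lebesgue K u)"

text \<open>For a merely bounded right-hand side \<open>f\<close> and an integrable coefficient \<open>a\<close>, the equation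
  \<open>u\<^sub>t - a(t) \<Delta>\<^sub>x u = f\<close> is an equation between distributions on \<open>\<Omega> \<times> (0, T)\<close>. As \<open>a\<close> does
  not depend on \<open>x\<close>, the distribution \<open>a(t) \<Delta>\<^sub>x u\<close> is \<open>\<Delta>\<^sub>x (a(t) u)\<close>. The local integrability
  requirements make \<open>u\<close>, \<open>a(t) u\<close> and \<open>f\<close> regular distributions.\<close>

definition solves_heat_equation ::
    "(real ^ 'n) set \<Rightarrow> real \<Rightarrow> (real \<Rightarrow> real) \<Rightarrow> ((real ^ 'n) \<times> real \<Rightarrow> real) \<Rightarrow>
     ((real ^ 'n) \<times> real \<Rightarrow> real) \<Rightarrow> bool" where
  "solves_heat_equation \<Omega> T a f u \<longleftrightarrow>
     locally_integrable_on (\<Omega> \<times> {0<..<T}) u \<and>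
     locally_integrable_on (\<Omega> \<times> {0<..<T}) (\<lambda>(x, t). a t * u (x, t)) \<and>
     locally_integrable_on (\<Omega> \<times> {0<..<T}) f \<and>
     (\<forall>\<phi>. test_function (\<Omega> \<times> {0<..<T}) \<phi> \<longrightarrow>
        (LINT p:\<Omega> \<times> {0<..<T}|lebesgue.
            u p * (- time_deriv \<phi> p) - a (snd p) * u p * space_laplacian \<phi> p)
        = (LINT p:\<Omega> \<times> {0<..<T}|lebesgue. f p * \<phi> p))"

end

theory Submission
  imports Defs "HOL-Probability.Distributions"
begin

text \<open>
  Both the estimate and the initial condition come from the heat kernel having total mass one (or
  zero, at non-positive times): the inner integral of the volume potential is bounded by
  \<open>sup \<bar>f\<bar>\<close>, the outer one contributes the length \<open>t\<close>, and the bound \<open>t sup \<bar>f\<bar>\<close> tends to zero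
  uniformly in \<open>x\<close>.

  The equation holds in the sense of distributions, so it is tested against \<open>\<phi>\<close>. By Fubini the
  kernel can be moved from \<open>f\<close> to the test function, and everything reduces to the duality
  statement \<open>integral_heat_kernel_adjoint_heat\<close>: for every \<open>\<xi>\<close> and \<open>0 \<le> \<tau> \<le> T\<close>, integrating
  \<open>- \<phi>\<^sub>t - a(t) \<Delta>\<phi>\<close> against the kernel issuing from \<open>(\<xi>, \<tau>)\<close> returns \<open>\<phi>(\<xi>, \<tau>)\<close>. For this, put
  \<open>b(t) = \<integral>\<^sub>\<tau>\<^sup>t a\<close> and let \<open>W(s, t)\<close> be the heat flow of \<open>\<phi>(\<cdot>, t)\<close> at time \<open>s\<close>, evaluated at \<open>\<xi>\<close>.
  Then \<open>W(b(t), t)\<close> equals \<open>\<phi>(\<xi>, \<tau>)\<close> at \<open>t = \<tau>\<close> and vanishes at \<open>t = T\<close>, while its formal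
  derivative \<open>a W\<^sub>s + W\<^sub>t\<close> is the kernel integral of \<open>a \<Delta>\<phi> + \<phi>\<^sub>t\<close> over the time slice.

  Two points need care. First, \<open>W\<close> and \<open>W\<^sub>s\<close> must be continuous up to \<open>s = 0\<close>, where the kernel
  degenerates. Writing \<open>W(s, t) = \<integral> G(z) \<phi>(\<xi> + \<surd>s z, t) dz\<close> with the fixed Gaussian \<open>G\<close> puts all
  the dependence on \<open>s\<close> into the smooth function \<open>\<phi>\<close>. For \<open>s > 0\<close>, Gaussian integration by parts
  identifies \<open>W\<^sub>s\<close> with the heat flow of \<open>\<Delta>\<phi>\<close>, which is again continuous up to \<open>s = 0\<close>. Second,
  \<open>a\<close> is only integrable, so \<open>b\<close> is absolutely continuous but in general not \<open>C\<^sup>1\<close>. The chain rule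
  in integrated form (\<open>has_integral_chain_rule_indefinite_integral\<close>) is obtained by telescoping over
  fine partitions, with uniform continuity of \<open>W\<^sub>s\<close> and \<open>W\<^sub>t\<close> and without differentiating \<open>b\<close>.

  The assumption that the zeros of \<open>a\<close> are isolated makes \<open>b(t) > 0\<close> for \<open>t > \<tau>\<close>, so that the
  kernel really acts on each later time slice. Lebesgue measurable data are replaced by Borel
  representatives, which makes Fubini applicable on products of Borel spaces.
\<close>

section \<open>The heat kernel\<close>

lemma heat_kernel_nonneg: "heat_kernel z s \<ge> 0"
  by (simp add: heat_kernel_def)

lemma borel_measurable_heat_kernel [measurable (raw)]:
  fixes X :: "'c \<Rightarrow> real ^ 'n"
  assumes [measurable]: "X \<in> borel_measurable M" "s \<in> borel_measurable M"
  shows "(\<lambda>w. heat_kernel (X w) (s w)) \<in> borel_measurable M"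
  unfolding heat_kernel_def by measurable

text \<open>The kernel at time \<open>s\<close> is the centred Gaussian of variance \<open>2 s\<close> in each coordinate; hence its
  total mass is one.\<close>
lemma heat_kernel_eq_prod_normal_density:
  fixes z :: "real ^ 'n"
  assumes "s > 0"
  shows "heat_kernel z s = (\<Prod>b\<in>Basis. normal_density 0 (sqrt (2 * s)) (z \<bullet> b))"
proof -
  have "(4 * pi * s) powr (- real CARD('n) / 2) = ((4 * pi * s) powr (- (1 / 2))) powr real CARD('n)"
    using assms by (simp add: powr_powr)
  also have "\<dots> = ((4 * pi * s) powr (- (1 / 2))) ^ CARD('n)"
    using assms by (simp add: powr_realpow)
  also have "(4 * pi * s) powr (- (1 / 2)) = 1 / sqrt (4 * pi * s)"
    using powr_half_sqrt[of "4 * pi * s"] assms by (simp only: powr_minus_divide) simp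
  finally have c: "(4 * pi * s) powr (- real CARD('n) / 2) = (1 / sqrt (4 * pi * s)) ^ DIM(real ^ 'n)"
    by simp
  have "(norm z)\<^sup>2 = (\<Sum>b\<in>Basis. (z \<bullet> b)\<^sup>2)"
    unfolding power2_norm_eq_inner by (subst euclidean_inner) (simp add: power2_eq_square)
  then have e: "exp (- (norm z)\<^sup>2 / (4 * s)) = (\<Prod>b\<in>Basis. exp (- (z \<bullet> b)\<^sup>2 / (4 * s)))"
    by (simp add: exp_sum[symmetric] sum_divide_distrib sum_negf)
  show ?thesis
    unfolding normal_density_def prod.distrib prod_constant
    using assms unfolding heat_kernel_def c e by (simp add: mult.assoc)
qed

lemma nn_integral_heat_kernel:
  fixes s :: real
  assumes "s > 0"
  shows "(\<integral>\<^sup>+ z. heat_kernel (z :: real ^ 'n) s \<partial>lborel) = 1"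
proof -
  have one: "(\<integral>\<^sup>+ x. normal_density 0 (sqrt (2 * s)) x \<partial>lborel) = 1"
    using assms by (subst nn_integral_eq_integral) auto
  have "(\<integral>\<^sup>+ z. heat_kernel (z :: real ^ 'n) s \<partial>lborel)
      = (\<integral>\<^sup>+ z. (\<Prod>b\<in>Basis. ennreal (normal_density 0 (sqrt (2 * s)) ((z :: real ^ 'n) \<bullet> b))) \<partial>lborel)"
    by (simp add: heat_kernel_eq_prod_normal_density[OF assms] prod_ennreal)
  also have "\<dots> = 1"
    by (subst nn_integral_lborel_prod) (simp_all add: one)
  finally show ?thesis .
qed

lemma integrable_heat_kernel: "integrable lborel (\<lambda>z :: real ^ 'n. heat_kernel z s)"
proof (cases "s > 0")
  case True
  then show ?thesis
    by (intro integrableI_nonneg) (auto simp: nn_integral_heat_kernel heat_kernel_nonneg)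
qed (simp add: heat_kernel_def)

lemma integral_heat_kernel: "s > 0 \<Longrightarrow> (\<integral>z. heat_kernel (z :: real ^ 'n) s \<partial>lborel) = 1"
  by (simp add: integral_eq_nn_integral nn_integral_heat_kernel heat_kernel_nonneg)

lemma lborel_integral_translate:
  fixes g :: "'a::euclidean_space \<Rightarrow> real"
  assumes [measurable]: "g \<in> borel_measurable borel"
  shows "(\<integral>x. g (v + x) \<partial>lborel) = (\<integral>x. g x \<partial>lborel)"
  by (subst (2) lborel_distr_plus[of v, symmetric]) (simp add: integral_distr)

lemma lborel_integrable_translate:
  fixes g :: "'a::euclidean_space \<Rightarrow> real"
  assumes [measurable]: "g \<in> borel_measurable borel"
  shows "integrable lborel (\<lambda>x. g (v + x)) \<longleftrightarrow> integrable lborel g"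
  by (subst (2) lborel_distr_plus[of v, symmetric]) (simp add: integrable_distr_eq)

text \<open>Parabolic scaling, with the Jacobian of \<open>z \<mapsto> \<surd>s z\<close> already included.\<close>
lemma heat_kernel_scale:
  fixes z :: "real ^ 'n"
  assumes "s > 0"
  shows "sqrt s ^ CARD('n) * heat_kernel (sqrt s *\<^sub>R z) s = heat_kernel z 1"
proof -
  have "(4 * pi * s) powr (- real CARD('n) / 2)
      = (4 * pi) powr (- real CARD('n) / 2) * s powr (- real CARD('n) / 2)"
    using assms by (subst powr_mult) auto
  moreover have "sqrt s ^ CARD('n) * s powr (- real CARD('n) / 2) = 1"
    using assms by (simp add: powr_half_sqrt[symmetric] powr_realpow[symmetric] powr_powr
        powr_add[symmetric])
  moreover have "- (norm (sqrt s *\<^sub>R z))\<^sup>2 / (4 * s) = - (norm z)\<^sup>2 / (4 * 1)"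
    using assms by (simp add: power_mult_distrib)
  ultimately show ?thesis
    using assms unfolding heat_kernel_def
    by (simp only: mult.assoc mult.left_commute[of "sqrt s ^ CARD('n)"] if_True)
      (simp add: mult.commute[of "s powr _"])
qed

text \<open>Scaling turns the heat flow at time \<open>s\<close> into an average against the kernel at time \<open>1\<close>, which
  no longer depends on \<open>s\<close>. This is what makes the limit \<open>s \<rightarrow> 0\<close> harmless.\<close>
lemma integral_heat_kernel_rescale:
  fixes h :: "real ^ 'n \<Rightarrow> real"
  assumes [measurable]: "h \<in> borel_measurable borel" and s: "s > 0"
  shows "(\<integral>x. heat_kernel (x - \<xi>) s * h x \<partial>lborel)
       = (\<integral>z. heat_kernel z 1 * h (\<xi> + sqrt s *\<^sub>R z) \<partial>lborel)"
proof -
  let ?g = "\<lambda>x. heat_kernel (x - \<xi>) s * h x"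
  have "lborel = density (distr lborel borel (\<lambda>z. \<xi> + sqrt s *\<^sub>R z)) (\<lambda>_. ennreal (sqrt s ^ CARD('n)))"
    using lborel_affine[of "sqrt s" \<xi>] s by (simp add: ennreal_power)
  then have "(\<integral>x. ?g x \<partial>lborel)
      = (\<integral>x. ?g x \<partial>density (distr lborel borel (\<lambda>z. \<xi> + sqrt s *\<^sub>R z)) (\<lambda>_. ennreal (sqrt s ^ CARD('n))))"
    by (rule arg_cong)
  also have "\<dots> = (\<integral>x. sqrt s ^ CARD('n) * ?g x \<partial>distr lborel borel (\<lambda>z. \<xi> + sqrt s *\<^sub>R z))"
    using s by (subst integral_density) auto
  also have "\<dots> = (\<integral>z. sqrt s ^ CARD('n) * ?g (\<xi> + sqrt s *\<^sub>R z) \<partial>lborel)"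
    by (subst integral_distr) auto
  also have "\<dots> = (\<integral>z. heat_kernel z 1 * h (\<xi> + sqrt s *\<^sub>R z) \<partial>lborel)"
    by (simp add: mult.assoc[symmetric] heat_kernel_scale[OF s])
  finally show ?thesis .
qed

section \<open>Differentiation under the integral and Gaussian integration by parts\<close>

text \<open>The mean value theorem bounds the difference quotients by the same \<open>D\<close> as the derivatives, so
  dominated convergence applies to them.\<close>
lemma has_real_derivative_integral_dominated:
  fixes g g' :: "real \<Rightarrow> 'b \<Rightarrow> real"
  assumes deriv: "\<And>r x. ((\<lambda>r. g r x) has_real_derivative g' r x) (at r)"
    and bound: "\<And>r x. \<bar>g' r x\<bar> \<le> D x"
    and D: "integrable M D"
    and g: "\<And>r. integrable M (g r)"
    and meas: "\<And>r. g' r \<in> borel_measurable M"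
  shows "((\<lambda>r. \<integral>x. g r x \<partial>M) has_real_derivative (\<integral>x. g' r x \<partial>M)) (at r)"
proof -
  let ?q = "\<lambda>r' x. (g r' x - g r x) / (r' - r)"
  have q: "(\<integral>x. ?q r' x \<partial>M) = ((\<integral>x. g r' x \<partial>M) - (\<integral>x. g r x \<partial>M)) / (r' - r)" for r'
    using g by simp
  have q_bound: "norm (?q r' x) \<le> D x" if "r' \<noteq> r" for r' x
  proof -
    have "norm (g r' x - g r x) \<le> D x * norm (r' - r)"
      using deriv bound
      by (intro field_differentiable_bound[of UNIV "\<lambda>r. g r x" "\<lambda>r. g' r x"])
        (auto intro: has_field_derivative_at_within)
    with that show ?thesis
      by (simp add: divide_le_eq)
  qed
  have "((\<lambda>r'. \<integral>x. ?q r' x \<partial>M) \<longlongrightarrow> (\<integral>x. g' r x \<partial>M)) (at r)"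
    unfolding tendsto_at_iff_sequentially comp_def
  proof (intro allI impI)
    fix X :: "nat \<Rightarrow> real"
    assume X: "\<forall>i. X i \<in> UNIV - {r}" "X \<longlonglongrightarrow> r"
    show "(\<lambda>i. \<integral>x. ?q (X i) x \<partial>M) \<longlonglongrightarrow> (\<integral>x. g' r x \<partial>M)"
    proof (rule integral_dominated_convergence[where w = D])
      show "g' r \<in> borel_measurable M" by (rule meas)
      show "?q (X i) \<in> borel_measurable M" for i
        using g by (auto intro!: borel_measurable_integrable)
      show "AE x in M. (\<lambda>i. ?q (X i) x) \<longlonglongrightarrow> g' r x"
      proof (rule AE_I2)
        fix x
        have "((\<lambda>r'. ?q r' x) \<longlongrightarrow> g' r x) (at r)"
          using deriv[of x r] by (simp add: has_field_derivative_iff)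
        then show "(\<lambda>i. ?q (X i) x) \<longlonglongrightarrow> g' r x"
          using X unfolding tendsto_at_iff_sequentially comp_def by blast
      qed
      show "AE x in M. norm (?q (X i) x) \<le> D x" for i
        using X(1) by (intro AE_I2 q_bound) auto
    qed (rule D)
  qed
  then show ?thesis
    by (simp only: has_field_derivative_iff q)
qed

text \<open>Integrate \<open>h(x + v) - h(x) = \<integral>\<^sub>0\<^sup>1 h'(x + r v) dr\<close> over \<open>x\<close>: by translation invariance the
  left-hand side integrates to zero and the right-hand side to \<open>\<integral> h'\<close>. This replaces the
  divergence theorem on the whole space.\<close>
lemma integral_directional_derivative_eq_0:
  fixes h h' :: "'a::euclidean_space \<Rightarrow> real"
  assumes deriv: "\<And>x. ((\<lambda>r. h (x + r *\<^sub>R v)) has_real_derivative h' x) (at 0)"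
    and cont: "continuous_on UNIV h'"
    and h: "integrable lborel h" and h': "integrable lborel h'"
  shows "(\<integral>x. h' x \<partial>lborel) = 0"
proof -
  have [measurable]: "h' \<in> borel_measurable borel" "h \<in> borel_measurable borel"
    using h h' by (auto dest: borel_measurable_integrable)
  have line: "((\<lambda>r. h (x + r *\<^sub>R v)) has_real_derivative h' (x + r *\<^sub>R v)) (at r)" for x r
  proof -
    have "((\<lambda>u. h (x + r *\<^sub>R v + u *\<^sub>R v)) has_real_derivative h' (x + r *\<^sub>R v)) (at 0)"
      by (rule deriv)
    then show ?thesis
      using DERIV_shift[of "\<lambda>u. h (x + u *\<^sub>R v)" "h' (x + r *\<^sub>R v)" 0 r]
      by (simp add: algebra_simps)
  qed
  have FTC: "(\<integral>r. h' (x + r *\<^sub>R v) * indicator {0..1} r \<partial>lborel) = h (x + v) - h x" for x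
    using integral_FTC_Icc_real[of 0 1 "\<lambda>r. h (x + r *\<^sub>R v)" "\<lambda>r. h' (x + r *\<^sub>R v)"] line
      continuous_on_compose2[OF cont, of UNIV "\<lambda>r. x + r *\<^sub>R v"]
    by (auto intro!: continuous_intros simp: continuous_on_eq_continuous_at)
  let ?k = "\<lambda>(x, r). h' (x + r *\<^sub>R v) * indicator {0..1::real} r"
  have shift: "(\<integral>x. h' (x + r *\<^sub>R v) \<partial>lborel) = (\<integral>x. h' x \<partial>lborel)"
      "integrable lborel (\<lambda>x. h' (x + r *\<^sub>R v))"
      "(\<integral>x. \<bar>h' (x + r *\<^sub>R v)\<bar> \<partial>lborel) = (\<integral>x. \<bar>h' x\<bar> \<partial>lborel)" for r
    using lborel_integral_translate[of h' "r *\<^sub>R v"] lborel_integrable_translate[of h' "r *\<^sub>R v"]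
      lborel_integral_translate[of "\<lambda>x. \<bar>h' x\<bar>" "r *\<^sub>R v"] h'
    by (simp_all add: add.commute)
  have "integrable (lborel \<Otimes>\<^sub>M lborel) (\<lambda>(r, x). ?k (x, r))"
  proof (rule lborel_pair.Fubini_integrable)
    show "integrable lborel (\<lambda>r. \<integral>x. norm ((\<lambda>(r, x). ?k (x, r)) (r, x)) \<partial>lborel)"
      by (simp add: abs_mult shift)
    show "AE r in lborel. integrable lborel (\<lambda>x. (\<lambda>(r, x). ?k (x, r)) (r, x))"
      by (auto simp: shift)
  qed simp
  from lborel_pair.integrable_product_swap[OF this] have k: "integrable (lborel \<Otimes>\<^sub>M lborel) ?k"
    by simp
  have "(\<integral>x. h (x + v) - h x \<partial>lborel) = (\<integral>x. (\<integral>r. ?k (x, r) \<partial>lborel) \<partial>lborel)"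
    by (simp add: FTC)
  also have "\<dots> = (\<integral>r. (\<integral>x. ?k (x, r) \<partial>lborel) \<partial>lborel)"
    using lborel_pair.Fubini_integral[of "\<lambda>x r. ?k (x, r)"] k by simp
  also have "\<dots> = (\<integral>x. h' x \<partial>lborel)"
    by (simp add: shift)
  finally show ?thesis
    using lborel_integral_translate[of h v] lborel_integrable_translate[of h v] h
    by (simp add: add.commute)
qed

text \<open>The linear factor is absorbed by half of the Gaussian exponent, which leaves a multiple of the
  kernel at time \<open>2\<close>.\<close>
lemma integrable_norm_mult_heat_kernel:
  "integrable lborel (\<lambda>z :: real ^ 'n. norm z * heat_kernel z 1)"
proof -
  let ?c = "(4 * pi) powr (- real CARD('n) / 2)" and ?d = "(8 * pi) powr (- real CARD('n) / 2)"
  have "norm z * heat_kernel z 1 \<le> (2 * ?c / ?d) * heat_kernel z 2" for z :: "real ^ 'n"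
  proof -
    \<comment> \<open>A perfect square gives \<open>r \<le> 2 (1 + r\<^sup>2 / 8)\<close>, which is dominated by the exponential.\<close>
    have "0 \<le> (norm z / 2 - 1)\<^sup>2" by simp
    then have "norm z \<le> 2 * (1 + (norm z)\<^sup>2 / 8)"
      by (simp add: power2_eq_square algebra_simps)
    also have "\<dots> \<le> 2 * exp ((norm z)\<^sup>2 / 8)"
      by (intro mult_left_mono) auto
    finally have "norm z * exp (- (norm z)\<^sup>2 / 4)
        \<le> 2 * exp ((norm z)\<^sup>2 / 8) * exp (- (norm z)\<^sup>2 / 4)"
      by (intro mult_right_mono) auto
    also have "\<dots> = 2 * exp (- (norm z)\<^sup>2 / 8)"
      by (simp add: mult.assoc exp_add[symmetric])
    finally show ?thesis
      by (simp add: heat_kernel_def mult.left_commute[of "norm z"] mult_left_mono)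
  qed
  then obtain K where K: "\<And>z :: real ^ 'n. norm z * heat_kernel z 1 \<le> K * heat_kernel z 2"
    by blast
  show ?thesis
  proof (rule Bochner_Integration.integrable_bound)
    show "integrable lborel (\<lambda>z :: real ^ 'n. K * heat_kernel z 2)"
      using integrable_heat_kernel by auto
    show "AE z in lborel. norm (norm z * heat_kernel z 1) \<le> norm (K * heat_kernel (z :: real ^ 'n) 2)"
    proof (rule AE_I2)
      fix z :: "real ^ 'n"
      show "norm (norm z * heat_kernel z 1) \<le> norm (K * heat_kernel z 2)"
        using K[of z] heat_kernel_nonneg[of z 1]
        by (metis abs_ge_self abs_of_nonneg mult_nonneg_nonneg norm_ge_zero order_trans real_norm_def)
    qed
  qed measurable
qed

text \<open>The kernel satisfies \<open>\<partial>\<^sub>i G = - (z\<^sub>i / 2) G\<close>; applying this inside \<open>\<integral> \<partial>\<^sub>i (G \<psi>) = 0\<close> trades a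
  factor \<open>z\<^sub>i\<close> for a derivative of \<open>\<psi>\<close> below.\<close>
lemma heat_kernel_has_derivative_axis:
  fixes z :: "real ^ 'n"
  shows "((\<lambda>r. heat_kernel (z + r *\<^sub>R axis i 1) 1) has_real_derivative - (z $ i / 2) * heat_kernel z 1) (at 0)"
proof -
  have n: "(norm (z + r *\<^sub>R axis i 1))\<^sup>2 = (norm z)\<^sup>2 + 2 * r * z $ i + r\<^sup>2" for r
    unfolding power2_norm_eq_inner by (simp add: inner_add inner_axis inner_axis' power2_eq_square inner_axis_axis algebra_simps)
  show ?thesis
    unfolding heat_kernel_def n
    by (auto intro!: derivative_eq_intros)
qed

lemma continuous_on_heat_kernel: "continuous_on UNIV (\<lambda>z :: real ^ 'n. heat_kernel z 1)"
  unfolding heat_kernel_def by (auto intro!: continuous_intros)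

lemma integrable_heat_kernel_mult:
  fixes \<psi> :: "real ^ 'n \<Rightarrow> real"
  assumes [measurable]: "\<psi> \<in> borel_measurable borel" and bound: "\<And>z. \<bar>\<psi> z\<bar> \<le> C"
  shows "integrable lborel (\<lambda>z. heat_kernel (z - \<xi>) s * \<psi> z)"
proof (rule Bochner_Integration.integrable_bound)
  show "integrable lborel (\<lambda>z :: real ^ 'n. C * heat_kernel (z - \<xi>) s)"
    using lborel_integrable_translate[of "\<lambda>z. heat_kernel z s" "- \<xi>"]
    by (simp add: integrable_heat_kernel)
  show "AE z in lborel. norm (heat_kernel (z - \<xi>) s * \<psi> z) \<le> norm (C * heat_kernel (z - \<xi>) s)"
    using bound by (intro AE_I2)
      (auto simp: abs_mult heat_kernel_nonneg mult.commute[of "heat_kernel _ _"]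
        intro!: mult_right_mono intro: order_trans[OF _ abs_ge_self])
qed measurable

lemma integrable_heat_kernel_component_mult:
  fixes \<psi> :: "real ^ 'n \<Rightarrow> real"
  assumes [measurable]: "\<psi> \<in> borel_measurable borel" and bound: "\<And>z. \<bar>\<psi> z\<bar> \<le> C"
  shows "integrable lborel (\<lambda>z. heat_kernel z 1 * (z $ i * \<psi> z))"
proof (rule Bochner_Integration.integrable_bound)
  show "integrable lborel (\<lambda>z :: real ^ 'n. C * (norm z * heat_kernel z 1))"
    by (intro integrable_mult_right integrable_norm_mult_heat_kernel)
  show "AE z in lborel. norm (heat_kernel z 1 * (z $ i * \<psi> z)) \<le> norm (C * (norm z * heat_kernel z 1))"
  proof (rule AE_I2)
    fix z :: "real ^ 'n"
    have "\<bar>z $ i\<bar> * \<bar>\<psi> z\<bar> \<le> norm z * \<bar>C\<bar>"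
      using bound[of z] component_le_norm_cart[of z i] by (intro mult_mono) auto
    then have "heat_kernel z 1 * (\<bar>z $ i\<bar> * \<bar>\<psi> z\<bar>) \<le> heat_kernel z 1 * (norm z * \<bar>C\<bar>)"
      by (rule mult_left_mono) (rule heat_kernel_nonneg)
    then show "norm (heat_kernel z 1 * (z $ i * \<psi> z)) \<le> norm (C * (norm z * heat_kernel z 1))"
      by (simp add: abs_mult heat_kernel_nonneg mult_ac)
  qed
qed measurable

lemma gaussian_integration_by_parts:
  fixes \<psi> \<psi>' :: "real ^ 'n \<Rightarrow> real"
  assumes deriv: "\<And>z. ((\<lambda>r. \<psi> (z + r *\<^sub>R axis i 1)) has_real_derivative \<psi>' z) (at 0)"
    and cont: "continuous_on UNIV \<psi>" "continuous_on UNIV \<psi>'"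
    and bound: "\<And>z. \<bar>\<psi> z\<bar> \<le> C" "\<And>z. \<bar>\<psi>' z\<bar> \<le> C"
  shows "(\<integral>z. heat_kernel z 1 * (z $ i * \<psi> z) \<partial>lborel) = 2 * (\<integral>z. heat_kernel z 1 * \<psi>' z \<partial>lborel)"
proof -
  let ?G = "\<lambda>z :: real ^ 'n. heat_kernel z 1"
  have [measurable]: "\<psi> \<in> borel_measurable borel" "\<psi>' \<in> borel_measurable borel"
    using cont by (auto intro: borel_measurable_continuous_onI)
  have i1: "integrable lborel (\<lambda>z. ?G z * \<psi> z)" and i2: "integrable lborel (\<lambda>z. ?G z * \<psi>' z)"
    by (auto intro!: integrable_heat_kernel_mult[where \<xi> = 0, simplified] bound)
  have i3: "integrable lborel (\<lambda>z. ?G z * (z $ i * \<psi> z))"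
    by (auto intro!: integrable_heat_kernel_component_mult bound)
  have "(\<integral>z. ?G z * \<psi>' z - 1 / 2 * (?G z * (z $ i * \<psi> z)) \<partial>lborel) = 0"
  proof (rule integral_directional_derivative_eq_0)
    show "((\<lambda>r. ?G (z + r *\<^sub>R axis i 1) * \<psi> (z + r *\<^sub>R axis i 1)) has_real_derivative
        ?G z * \<psi>' z - 1 / 2 * (?G z * (z $ i * \<psi> z))) (at 0)" for z
      using DERIV_mult[OF heat_kernel_has_derivative_axis[of z i] deriv[of z]]
      by (simp add: algebra_simps)
    show "continuous_on UNIV (\<lambda>z. ?G z * \<psi>' z - 1 / 2 * (?G z * (z $ i * \<psi> z)))"
      by (intro continuous_intros continuous_on_heat_kernel cont continuous_on_component)
  qed (use i1 i2 i3 in auto)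
  then show ?thesis
    using i2 i3 by simp
qed

section \<open>Test functions\<close>

lemma test_function_has_derivative:
  assumes "test_function U \<phi>"
  shows "(\<phi> has_derivative (\<lambda>h. dderiv h \<phi> p)) (at p)"
proof -
  have "k_smooth (Suc 0) \<phi>"
    using assms unfolding test_function_def by blast
  then show ?thesis
    unfolding dderiv_def by (simp add: frechet_derivative_works)
qed

text \<open>On the open complement of the support a test function vanishes identically, hence so do its
  derivatives.\<close>
lemma test_function_dderiv:
  assumes "test_function U \<phi>"
  shows "test_function U (dderiv v \<phi>)"
proof -
  let ?S = "closure (support_on UNIV \<phi>)"
  have "k_smooth k (dderiv v \<phi>)" for k
  proof -
    have "k_smooth (Suc k) \<phi>"
      using assms unfolding test_function_def by blast
    then show ?thesis by simp
  qed
  moreover have "support_on UNIV (dderiv v \<phi>) \<subseteq> ?S"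
  proof (rule ccontr)
    assume "\<not> support_on UNIV (dderiv v \<phi>) \<subseteq> ?S"
    then obtain p where p: "p \<in> - ?S" "dderiv v \<phi> p \<noteq> 0"
      by (auto simp: support_on_def)
    have "\<phi> q = 0" if "q \<in> - ?S" for q
    proof -
      have "q \<notin> support_on UNIV \<phi>" using that closure_subset by blast
      then show ?thesis by (simp add: support_on_def)
    qed
    then have "(\<phi> has_derivative (\<lambda>h. 0)) (at p)"
      using has_derivative_transform_within_open[of "\<lambda>_. 0" "\<lambda>h. 0" p UNIV "- ?S" \<phi>] p(1) by auto
    then have "(\<lambda>h. dderiv h \<phi> p) = (\<lambda>h. 0)"
      using test_function_has_derivative[OF assms] has_derivative_unique by blast
    with p(2) show False by meson
  qed
  then have "closure (support_on UNIV (dderiv v \<phi>)) \<subseteq> ?S"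
    by (simp add: closure_minimal)
  ultimately show ?thesis
    using assms unfolding test_function_def
    by (metis closed_closure compact_Int_closed inf.absorb_iff2 subset_trans)
qed

lemma test_function_continuous: "test_function U \<phi> \<Longrightarrow> continuous_on UNIV \<phi>"
  unfolding test_function_def by (metis k_smooth.simps(1))

lemma test_function_eq_0: "test_function U \<phi> \<Longrightarrow> p \<notin> U \<Longrightarrow> \<phi> p = 0"
  using closure_subset[of "support_on UNIV \<phi>"] by (auto simp: test_function_def support_on_def)

lemma test_function_bounded_support:
  assumes "test_function U \<phi>"
  shows "\<exists>K. compact K \<and> (\<forall>p. p \<notin> K \<longrightarrow> \<phi> p = 0)"
proof (intro exI conjI allI impI)
  show "compact (closure (support_on UNIV \<phi>))"
    using assms by (simp add: test_function_def)
  show "\<phi> p = 0" if "p \<notin> closure (support_on UNIV \<phi>)" for p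
    using that closure_subset[of "support_on UNIV \<phi>"] by (auto simp: support_on_def)
qed

lemma test_function_bounded:
  assumes "test_function U \<phi>"
  obtains C where "C \<ge> 0" "\<And>p. \<bar>\<phi> p\<bar> \<le> C"
proof -
  obtain K where K: "compact K" "\<And>p. p \<notin> K \<Longrightarrow> \<phi> p = 0"
    using test_function_bounded_support[OF assms] by blast
  have "compact (\<phi> ` K)"
    using K(1) test_function_continuous[OF assms] continuous_on_subset
    by (blast intro: compact_continuous_image)
  then obtain C where C: "\<And>p. p \<in> K \<Longrightarrow> \<bar>\<phi> p\<bar> \<le> C"
    using compact_imp_bounded[of "\<phi> ` K"] unfolding bounded_iff by auto
  show ?thesis
    by (rule that[of "max C 0"]) (use C K(2) in \<open>force simp: le_max_iff_disj\<close>)+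
qed

lemma test_function_line_derivative:
  assumes "test_function U \<phi>"
  shows "((\<lambda>r. \<phi> (p + r *\<^sub>R v)) has_real_derivative dderiv v \<phi> (p + r *\<^sub>R v)) (at r)"
proof -
  have lin: "linear (\<lambda>h. dderiv h \<phi> (p + r *\<^sub>R v))"
    using test_function_has_derivative[OF assms] has_derivative_linear by blast
  have "((\<lambda>r. \<phi> (p + r *\<^sub>R v)) has_derivative (\<lambda>u. dderiv (u *\<^sub>R v) \<phi> (p + r *\<^sub>R v))) (at r)"
    by (rule has_derivative_compose[OF _ test_function_has_derivative[OF assms]])
      (auto intro!: derivative_eq_intros)
  then show ?thesis
    unfolding linear_cmul[OF lin] by (simp add: has_field_derivative_def mult_commute_abs)
qed

text \<open>The spatial derivatives enter the heat flow through the direction \<open>z\<close> of the Gaussian variable,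
  but integration by parts acts coordinate by coordinate.\<close>
lemma dderiv_space_direction:
  fixes \<phi> :: "(real ^ 'n) \<times> real \<Rightarrow> real"
  assumes "test_function U \<phi>"
  shows "dderiv (z, 0) \<phi> p = (\<Sum>i\<in>UNIV. z $ i * dderiv (axis i 1, 0) \<phi> p)"
proof -
  have lin: "linear (\<lambda>h. dderiv h \<phi> p)"
    using test_function_has_derivative[OF assms] has_derivative_linear by blast
  have "(\<Sum>i\<in>UNIV. z $ i *\<^sub>R (axis i 1 :: real ^ 'n, 0 :: real)) = (z, 0)"
    using basis_expansion[of z] by (simp add: prod_eq_iff fst_sum snd_sum scalar_mult_eq_scaleR)
  then have "dderiv (z, 0) \<phi> p = dderiv (\<Sum>i\<in>UNIV. z $ i *\<^sub>R (axis i 1 :: real ^ 'n, 0 :: real)) \<phi> p"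
    by simp
  also have "\<dots> = (\<Sum>i\<in>UNIV. z $ i * dderiv (axis i 1, 0) \<phi> p)"
    unfolding linear_sum[OF lin] linear_cmul[OF lin] by simp
  finally show ?thesis .
qed

section \<open>Heat flow of a test function\<close>

text \<open>The heat flow of \<open>h(\<cdot>, t)\<close> at time \<open>s\<close>, evaluated at \<open>\<xi>\<close>, in the scaled form. It makes
  sense for all real \<open>s\<close>, since \<open>sqrt\<close> is an odd continuous function on the whole line, but only
  \<open>s \<ge> 0\<close> carries the meaning of a flow.\<close>
definition gaussian_average ::
    "((real ^ 'n) \<times> real \<Rightarrow> real) \<Rightarrow> real ^ 'n \<Rightarrow> real \<Rightarrow> real \<Rightarrow> real" where
  "gaussian_average h \<xi> s t = (\<integral>z. heat_kernel z 1 * h (\<xi> + sqrt s *\<^sub>R z, t) \<partial>lborel)"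

lemma continuous_on_gaussian_average:
  fixes h :: "(real ^ 'n) \<times> real \<Rightarrow> real"
  assumes cont: "continuous_on UNIV h" and bound: "\<And>p. \<bar>h p\<bar> \<le> C"
  shows "continuous_on UNIV (\<lambda>(s, t). gaussian_average h \<xi> s t)"
  unfolding continuous_on_sequentially
proof (intro ballI allI impI, elim conjE)
  fix X :: "nat \<Rightarrow> real \<times> real" and q :: "real \<times> real"
  assume X: "X \<longlonglongrightarrow> q"
  have [measurable]: "h \<in> borel_measurable borel"
    using cont by (rule borel_measurable_continuous_onI)
  have "(\<lambda>n. \<integral>z. heat_kernel z 1 * h (\<xi> + sqrt (fst (X n)) *\<^sub>R z, snd (X n)) \<partial>lborel)
      \<longlonglongrightarrow> (\<integral>z. heat_kernel z 1 * h (\<xi> + sqrt (fst q) *\<^sub>R z, snd q) \<partial>lborel)"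
  proof (rule integral_dominated_convergence[where w = "\<lambda>z. C * heat_kernel z 1"])
    show "integrable lborel (\<lambda>z :: real ^ 'n. C * heat_kernel z 1)"
      by (intro integrable_mult_right integrable_heat_kernel)
    show "AE z in lborel. (\<lambda>n. heat_kernel z 1 * h (\<xi> + sqrt (fst (X n)) *\<^sub>R z, snd (X n)))
        \<longlonglongrightarrow> heat_kernel z 1 * h (\<xi> + sqrt (fst q) *\<^sub>R z, snd q)"
    proof (rule AE_I2)
      fix z :: "real ^ 'n"
      have "(\<lambda>n. (\<xi> + sqrt (fst (X n)) *\<^sub>R z, snd (X n))) \<longlonglongrightarrow> (\<xi> + sqrt (fst q) *\<^sub>R z, snd q)"
        using X by (intro tendsto_intros)
      then have "(\<lambda>n. h (\<xi> + sqrt (fst (X n)) *\<^sub>R z, snd (X n))) \<longlonglongrightarrow> h (\<xi> + sqrt (fst q) *\<^sub>R z, snd q)"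
        by (intro continuous_on_tendsto_compose[OF cont]) auto
      then show "(\<lambda>n. heat_kernel z 1 * h (\<xi> + sqrt (fst (X n)) *\<^sub>R z, snd (X n)))
          \<longlonglongrightarrow> heat_kernel z 1 * h (\<xi> + sqrt (fst q) *\<^sub>R z, snd q)"
        by (intro tendsto_intros)
    qed
    show "AE z in lborel. norm (heat_kernel z 1 * h (\<xi> + sqrt (fst (X n)) *\<^sub>R z, snd (X n)))
        \<le> C * heat_kernel z 1" for n
      using bound by (intro AE_I2)
        (simp add: abs_mult heat_kernel_nonneg mult.commute[of "heat_kernel _ _"] mult_right_mono)
  qed measurable
  then show "((\<lambda>(s, t). gaussian_average h \<xi> s t) \<circ> X) \<longlonglongrightarrow> (\<lambda>(s, t). gaussian_average h \<xi> s t) q"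
    by (simp add: gaussian_average_def comp_def case_prod_beta)
qed

lemma gaussian_average_0: "gaussian_average h \<xi> 0 t = h (\<xi>, t)"
  by (simp add: gaussian_average_def integral_heat_kernel)

lemma gaussian_average_has_time_derivative:
  assumes "test_function U \<phi>"
  shows "((\<lambda>t. gaussian_average \<phi> \<xi> s t) has_real_derivative gaussian_average (time_deriv \<phi>) \<xi> s t) (at t)"
proof -
  have td: "test_function U (time_deriv \<phi>)"
    unfolding time_deriv_def by (rule test_function_dderiv[OF assms])
  obtain C where C: "\<And>p. \<bar>time_deriv \<phi> p\<bar> \<le> C"
    using test_function_bounded[OF td] by metis
  obtain C' where C': "\<And>p. \<bar>\<phi> p\<bar> \<le> C'"
    using test_function_bounded[OF assms] by metis
  have [measurable]: "\<phi> \<in> borel_measurable borel" "time_deriv \<phi> \<in> borel_measurable borel"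
    using test_function_continuous[OF assms] test_function_continuous[OF td]
    by (auto intro: borel_measurable_continuous_onI)
  show ?thesis
    unfolding gaussian_average_def
  proof (rule has_real_derivative_integral_dominated[where D = "\<lambda>z. C * heat_kernel z 1"])
    fix r :: real and z :: "real ^ 'a"
    have "((\<lambda>r. \<phi> (\<xi> + sqrt s *\<^sub>R z, r)) has_real_derivative time_deriv \<phi> (\<xi> + sqrt s *\<^sub>R z, r)) (at r)"
      using test_function_line_derivative[OF assms, of "(\<xi> + sqrt s *\<^sub>R z, 0)" "(0, 1)" r]
      by (simp add: time_deriv_def)
    then show "((\<lambda>r. heat_kernel z 1 * \<phi> (\<xi> + sqrt s *\<^sub>R z, r)) has_real_derivative
        heat_kernel z 1 * time_deriv \<phi> (\<xi> + sqrt s *\<^sub>R z, r)) (at r)"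
      by (rule DERIV_cmult)
    show "\<bar>heat_kernel z 1 * time_deriv \<phi> (\<xi> + sqrt s *\<^sub>R z, r)\<bar> \<le> C * heat_kernel z 1"
      using C by (simp add: abs_mult heat_kernel_nonneg mult.commute[of "heat_kernel _ _"] mult_right_mono)
  next
    show "integrable lborel (\<lambda>z. C * heat_kernel (z :: real ^ 'a) 1)"
      by (intro integrable_mult_right integrable_heat_kernel)
    show "integrable lborel (\<lambda>z. heat_kernel z 1 * \<phi> (\<xi> + sqrt s *\<^sub>R z, r))" for r
      using C' by (intro integrable_heat_kernel_mult[where \<xi> = 0, simplified]) auto
  qed measurable
qed

text \<open>The heat equation for the flow of a test function. Put \<open>\<rho> = \<surd>s\<close>: differentiating in \<open>\<rho>\<close> gives
  \<open>\<integral> G z \<cdot> \<nabla>\<phi>(\<xi> + \<rho> z, t) dz\<close>, integration by parts turns this into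
  \<open>2 \<rho> \<integral> G \<Delta>\<phi>(\<xi> + \<rho> z, t) dz\<close>, and the factor \<open>2 \<rho>\<close> cancels against the derivative of \<open>\<surd>s\<close>.\<close>
lemma gaussian_average_has_scale_derivative:
  fixes \<phi> :: "(real ^ 'n) \<times> real \<Rightarrow> real"
  assumes tf: "test_function U \<phi>" and s: "s > 0"
  shows "((\<lambda>s. gaussian_average \<phi> \<xi> s t) has_real_derivative
           gaussian_average (space_laplacian \<phi>) \<xi> s t) (at s)"
proof -
  let ?D = "\<lambda>i. dderiv (axis i 1, 0) \<phi>"
  let ?DD = "\<lambda>i. dderiv (axis i 1, 0) (dderiv (axis i 1, 0) \<phi>)"
  have tfD: "test_function U (?D i)" and tfDD: "test_function U (?DD i)" for i
    by (intro test_function_dderiv tf)+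
  have "\<exists>C. \<forall>p. \<bar>?D i p\<bar> \<le> C" "\<exists>C. \<forall>p. \<bar>?DD i p\<bar> \<le> C" for i
    using test_function_bounded[OF tfD] test_function_bounded[OF tfDD] by metis+
  then obtain C1 C2 where C: "\<And>i p. \<bar>?D i p\<bar> \<le> C1 i" "\<And>i p. \<bar>?DD i p\<bar> \<le> C2 i"
    by metis
  obtain C' where C': "\<And>p. \<bar>\<phi> p\<bar> \<le> C'"
    using test_function_bounded[OF tf] by metis
  have cont: "continuous_on UNIV (?D i)" "continuous_on UNIV (?DD i)" for i
    by (rule test_function_continuous tfD tfDD)+
  have [measurable]: "\<phi> \<in> borel_measurable borel" "?D i \<in> borel_measurable borel"
      "?DD i \<in> borel_measurable borel" for i
    using test_function_continuous[OF tf] cont by (auto intro: borel_measurable_continuous_onI)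
  have parts: "(\<integral>z. heat_kernel z 1 * (z $ i * ?D i (\<xi> + \<rho> *\<^sub>R z, t)) \<partial>lborel)
      = 2 * \<rho> * (\<integral>z. heat_kernel z 1 * ?DD i (\<xi> + \<rho> *\<^sub>R z, t) \<partial>lborel)" for i \<rho>
  proof -
    have "(\<integral>z. heat_kernel z 1 * (z $ i * ?D i (\<xi> + \<rho> *\<^sub>R z, t)) \<partial>lborel)
        = 2 * (\<integral>z. heat_kernel z 1 * (\<rho> * ?DD i (\<xi> + \<rho> *\<^sub>R z, t)) \<partial>lborel)"
    proof (rule gaussian_integration_by_parts[where C = "max (C1 i) (\<bar>\<rho>\<bar> * C2 i)"])
      fix z :: "real ^ 'n"
      have line: "((\<lambda>r. ?D i ((\<xi> + \<rho> *\<^sub>R z, t) + r *\<^sub>R (axis i 1, 0))) has_real_derivative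
          ?DD i (\<xi> + \<rho> *\<^sub>R z, t)) (at (\<rho> * 0))"
        using test_function_line_derivative[OF tfD, of i "(\<xi> + \<rho> *\<^sub>R z, t)" "(axis i 1, 0)" 0] by simp
      show "((\<lambda>r. ?D i (\<xi> + \<rho> *\<^sub>R (z + r *\<^sub>R axis i 1), t)) has_real_derivative
          \<rho> * ?DD i (\<xi> + \<rho> *\<^sub>R z, t)) (at 0)"
        using DERIV_chain2[of "\<lambda>r. ?D i ((\<xi> + \<rho> *\<^sub>R z, t) + r *\<^sub>R (axis i 1, 0))" _ "\<lambda>r. \<rho> * r", OF line DERIV_cmult_Id]
        by (simp add: algebra_simps)
      show "\<bar>?D i (\<xi> + \<rho> *\<^sub>R z, t)\<bar> \<le> max (C1 i) (\<bar>\<rho>\<bar> * C2 i)"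
        using C(1) by (simp add: le_max_iff_disj)
      show "\<bar>\<rho> * ?DD i (\<xi> + \<rho> *\<^sub>R z, t)\<bar> \<le> max (C1 i) (\<bar>\<rho>\<bar> * C2 i)"
        using C(2) by (simp add: le_max_iff_disj abs_mult mult_left_mono)
    next
      show "continuous_on UNIV (\<lambda>z. ?D i (\<xi> + \<rho> *\<^sub>R z, t))"
        by (rule continuous_on_compose2[OF cont(1)]) (auto intro!: continuous_intros)
      show "continuous_on UNIV (\<lambda>z. \<rho> * ?DD i (\<xi> + \<rho> *\<^sub>R z, t))"
        by (intro continuous_intros continuous_on_compose2[OF cont(2)]) auto
    qed
    then show ?thesis by (simp add: mult.left_commute[of _ \<rho>])
  qed
  define K where "K \<rho> = (\<integral>z. heat_kernel z 1 * \<phi> (\<xi> + \<rho> *\<^sub>R z, t) \<partial>lborel)" for \<rho>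
  have K_deriv: "(K has_real_derivative
      (\<integral>z. heat_kernel z 1 * (\<Sum>i\<in>UNIV. z $ i * ?D i (\<xi> + \<rho> *\<^sub>R z, t)) \<partial>lborel)) (at \<rho>)" for \<rho>
    unfolding K_def
  proof (rule has_real_derivative_integral_dominated[where D = "\<lambda>z. (\<Sum>i\<in>UNIV. C1 i) * (norm z * heat_kernel z 1)"])
    fix r :: real and z :: "real ^ 'n"
    have "((\<lambda>r. \<phi> (\<xi> + r *\<^sub>R z, t)) has_real_derivative (\<Sum>i\<in>UNIV. z $ i * ?D i (\<xi> + r *\<^sub>R z, t))) (at r)"
      using test_function_line_derivative[OF tf, of "(\<xi>, t)" "(z, 0)" r]
      unfolding dderiv_space_direction[OF tf, of z] by simp
    then show "((\<lambda>r. heat_kernel z 1 * \<phi> (\<xi> + r *\<^sub>R z, t)) has_real_derivative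
        heat_kernel z 1 * (\<Sum>i\<in>UNIV. z $ i * ?D i (\<xi> + r *\<^sub>R z, t))) (at r)"
      by (rule DERIV_cmult)
    have "\<bar>\<Sum>i\<in>UNIV. z $ i * ?D i (\<xi> + r *\<^sub>R z, t)\<bar> \<le> norm z * (\<Sum>i\<in>UNIV. C1 i)"
      unfolding sum_distrib_left using C(1) component_le_norm_cart[of z]
      by (intro order_trans[OF sum_abs] sum_mono) (auto simp: abs_mult intro!: mult_mono)
    then have "heat_kernel z 1 * \<bar>\<Sum>i\<in>UNIV. z $ i * ?D i (\<xi> + r *\<^sub>R z, t)\<bar>
        \<le> heat_kernel z 1 * (norm z * (\<Sum>i\<in>UNIV. C1 i))"
      by (rule mult_left_mono) (rule heat_kernel_nonneg)
    then show "\<bar>heat_kernel z 1 * (\<Sum>i\<in>UNIV. z $ i * ?D i (\<xi> + r *\<^sub>R z, t))\<bar>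
        \<le> (\<Sum>i\<in>UNIV. C1 i) * (norm z * heat_kernel z 1)"
      by (simp add: abs_mult heat_kernel_nonneg mult_ac)
  next
    show "integrable lborel (\<lambda>z :: real ^ 'n. (\<Sum>i\<in>UNIV. C1 i) * (norm z * heat_kernel z 1))"
      by (intro integrable_mult_right integrable_norm_mult_heat_kernel)
    show "integrable lborel (\<lambda>z. heat_kernel z 1 * \<phi> (\<xi> + r *\<^sub>R z, t))" for r
      using C' by (intro integrable_heat_kernel_mult[where \<xi> = 0, simplified]) auto
  qed measurable
  have K_deriv_eq: "(\<integral>z. heat_kernel z 1 * (\<Sum>i\<in>UNIV. z $ i * ?D i (\<xi> + \<rho> *\<^sub>R z, t)) \<partial>lborel)
      = 2 * \<rho> * (\<integral>z. heat_kernel z 1 * space_laplacian \<phi> (\<xi> + \<rho> *\<^sub>R z, t) \<partial>lborel)" for \<rho>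
  proof -
    have i1: "integrable lborel (\<lambda>z. heat_kernel z 1 * (z $ i * ?D i (\<xi> + \<rho> *\<^sub>R z, t)))" for i
      using C(1) by (intro integrable_heat_kernel_component_mult) auto
    have i2: "integrable lborel (\<lambda>z. heat_kernel z 1 * ?DD i (\<xi> + \<rho> *\<^sub>R z, t))" for i
      using C(2) by (intro integrable_heat_kernel_mult[where \<xi> = 0, simplified]) auto
    have "(\<integral>z. heat_kernel z 1 * (\<Sum>i\<in>UNIV. z $ i * ?D i (\<xi> + \<rho> *\<^sub>R z, t)) \<partial>lborel)
        = (\<Sum>i\<in>UNIV. \<integral>z. heat_kernel z 1 * (z $ i * ?D i (\<xi> + \<rho> *\<^sub>R z, t)) \<partial>lborel)"
      by (simp only: sum_distrib_left) (rule Bochner_Integration.integral_sum[OF i1])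
    also have "\<dots> = 2 * \<rho> * (\<Sum>i\<in>UNIV. \<integral>z. heat_kernel z 1 * ?DD i (\<xi> + \<rho> *\<^sub>R z, t) \<partial>lborel)"
      by (simp only: parts sum_distrib_left)
    also have "(\<Sum>i\<in>UNIV. \<integral>z. heat_kernel z 1 * ?DD i (\<xi> + \<rho> *\<^sub>R z, t) \<partial>lborel)
        = (\<integral>z. heat_kernel z 1 * space_laplacian \<phi> (\<xi> + \<rho> *\<^sub>R z, t) \<partial>lborel)"
      by (simp only: space_laplacian_def sum_distrib_left)
        (rule Bochner_Integration.integral_sum[OF i2, symmetric])
    finally show ?thesis .
  qed
  have "(K has_real_derivative
      2 * sqrt s * (\<integral>z. heat_kernel z 1 * space_laplacian \<phi> (\<xi> + sqrt s *\<^sub>R z, t) \<partial>lborel)) (at (sqrt s))"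
    using K_deriv[of "sqrt s"] unfolding K_deriv_eq .
  from DERIV_chain2[OF this DERIV_real_sqrt[OF s]] s show ?thesis
    by (simp add: gaussian_average_def K_def field_simps)
qed

section \<open>Chain rule along an indefinite integral\<close>

text \<open>The substitute for ``zero derivative implies constant'': small increments relative to the
  function \<open>m\<close> add up over a uniform partition to at most \<open>\<epsilon> (m \<beta> - m \<alpha>)\<close>. The function \<open>m\<close> may be
  any function, so it can absorb increments that are not controlled by the length of the interval.\<close>
lemma eq_if_increments_small:
  fixes F m :: "real \<Rightarrow> real"
  assumes "\<alpha> \<le> \<beta>"
    and small: "\<And>\<epsilon>. \<epsilon> > 0 \<Longrightarrow> \<exists>\<delta>>0. \<forall>p q. \<alpha> \<le> p \<longrightarrow> p \<le> q \<longrightarrow> q \<le> \<beta> \<longrightarrow> q - p < \<delta> \<longrightarrow>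
                  \<bar>F q - F p\<bar> \<le> \<epsilon> * (m q - m p)"
  shows "F \<beta> = F \<alpha>"
proof -
  have main: "\<bar>F \<beta> - F \<alpha>\<bar> \<le> \<epsilon> * (m \<beta> - m \<alpha>)" if \<epsilon>: "\<epsilon> > 0" for \<epsilon>
  proof -
    obtain \<delta> where \<delta>: "\<delta> > 0" and inc: "\<And>p q. \<alpha> \<le> p \<Longrightarrow> p \<le> q \<Longrightarrow> q \<le> \<beta> \<Longrightarrow> q - p < \<delta> \<Longrightarrow>
        \<bar>F q - F p\<bar> \<le> \<epsilon> * (m q - m p)"
      using small[OF \<epsilon>] by blast
    obtain N :: nat where N: "(\<beta> - \<alpha>) / \<delta> < real N" "N > 0"
      using reals_Archimedean2[of "max 1 ((\<beta> - \<alpha>) / \<delta>)"] by force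
    define h where "h = (\<beta> - \<alpha>) / N"
    have h: "0 \<le> h" "h < \<delta>" "\<alpha> + real N * h = \<beta>"
      using N \<delta> \<open>\<alpha> \<le> \<beta>\<close> by (simp_all add: h_def field_simps)
    have "\<bar>F (\<alpha> + real i * h) - F \<alpha>\<bar> \<le> \<epsilon> * (m (\<alpha> + real i * h) - m \<alpha>)" if "i \<le> N" for i
      using that
    proof (induction i)
      case (Suc i)
      have "real (Suc i) * h \<le> real N * h"
        using Suc.prems h(1) by (intro mult_right_mono) auto
      then have "\<alpha> + real (Suc i) * h \<le> \<beta>"
        using h(3) by simp
      then have "\<bar>F (\<alpha> + real (Suc i) * h) - F (\<alpha> + real i * h)\<bar>
          \<le> \<epsilon> * (m (\<alpha> + real (Suc i) * h) - m (\<alpha> + real i * h))"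
        using h(1,2) by (intro inc) (auto simp: algebra_simps)
      with Suc show ?case
        by (simp add: right_diff_distrib)
    qed simp
    from this[of N] h(3) show ?thesis by simp
  qed
  have "\<bar>F \<beta> - F \<alpha>\<bar> \<le> 0"
  proof (rule field_le_epsilon)
    fix e :: real assume "e > 0"
    define c where "c = \<bar>m \<beta> - m \<alpha>\<bar> + 1"
    have "\<bar>F \<beta> - F \<alpha>\<bar> \<le> e / c * (m \<beta> - m \<alpha>)"
      using \<open>e > 0\<close> by (intro main) (simp add: c_def divide_pos_pos)
    also have "\<dots> \<le> e / c * c"
      using \<open>e > 0\<close> by (intro mult_left_mono) (simp_all add: c_def)
    also have "\<dots> = e"
      by (simp add: c_def)
    finally show "\<bar>F \<beta> - F \<alpha>\<bar> \<le> 0 + e" by simp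
  qed
  then show ?thesis by simp
qed

text \<open>The chain rule for \<open>t \<mapsto> W(b(t), t)\<close> with \<open>b' = a\<close> in integrated form, where \<open>a\<close> is only
  integrable. On a short interval \<open>[p, q]\<close> the mean value theorem writes the increment as
  \<open>W\<^sub>s (b q - b p) + W\<^sub>t (q - p)\<close> at intermediate points; since \<open>b q - b p = \<integral> a\<close>, it differs
  from the integral of \<open>a W\<^sub>s + W\<^sub>t\<close> only by the oscillation of \<open>W\<^sub>s\<close> and \<open>W\<^sub>t\<close> times
  \<open>(b q - b p) + (q - p)\<close>. Differentiability in \<open>s\<close> is required for positive \<open>s\<close> only, because the
  mean value theorem looks at interior points.\<close>
lemma has_integral_chain_rule_indefinite_integral:
  fixes \<alpha> \<beta> :: real and a :: "real \<Rightarrow> real" and W Ws Wt :: "real \<Rightarrow> real \<Rightarrow> real"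
  defines "b \<equiv> \<lambda>t. integral {\<alpha>..t} a"
  assumes "\<alpha> \<le> \<beta>"
    and a: "a absolutely_integrable_on {\<alpha>..\<beta>}"
    and nonneg: "\<And>t. t \<in> {\<alpha>..\<beta>} \<Longrightarrow> a t \<ge> 0"
    and Ws: "continuous_on UNIV (\<lambda>(s, t). Ws s t)" and Wt: "continuous_on UNIV (\<lambda>(s, t). Wt s t)"
    and W: "\<And>t. continuous_on UNIV (\<lambda>s. W s t)"
    and ds: "\<And>s t. s > 0 \<Longrightarrow> ((\<lambda>s. W s t) has_real_derivative Ws s t) (at s)"
    and dt: "\<And>s t. ((\<lambda>t. W s t) has_real_derivative Wt s t) (at t)"
  shows "((\<lambda>t. a t * Ws (b t) t + Wt (b t) t) has_integral (W (b \<beta>) \<beta> - W 0 \<alpha>)) {\<alpha>..\<beta>}"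
proof -
  let ?g = "\<lambda>t. a t * Ws (b t) t + Wt (b t) t"
  have a_int: "a integrable_on {\<alpha>..\<beta>}"
    using a by (rule set_lebesgue_integral_eq_integral)
  have a_sub: "a integrable_on {p..q}" if "\<alpha> \<le> p" "q \<le> \<beta>" for p q
    using a_int by (rule integrable_on_subinterval) (use that in auto)
  have b_cont: "continuous_on {\<alpha>..\<beta>} b"
    unfolding b_def by (rule indefinite_integral_continuous_1[OF a_int])
  have b_diff: "b q - b p = integral {p..q} a" if "\<alpha> \<le> p" "p \<le> q" "q \<le> \<beta>" for p q
    using Henstock_Kurzweil_Integration.integral_combine[of \<alpha> p q a] that a_sub[of \<alpha> q] by (simp add: b_def)
  have b_mono: "b p \<le> b q" if "\<alpha> \<le> p" "p \<le> q" "q \<le> \<beta>" for p q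
    using b_diff[OF that] Henstock_Kurzweil_Integration.integral_nonneg[OF a_sub[of p q]] nonneg that by auto
  have b0: "b \<alpha> = 0" by (simp add: b_def)
  have along: "continuous_on {\<alpha>..\<beta>} (\<lambda>t. V (b t) t)"
    if "continuous_on UNIV (\<lambda>(s, t). V s t)" for V :: "real \<Rightarrow> real \<Rightarrow> real"
    using continuous_on_compose2[OF that continuous_on_Pair[OF b_cont continuous_on_id]] by simp
  have "(\<lambda>t. Ws (b t) t * a t) absolutely_integrable_on {\<alpha>..\<beta>}"
    using along[OF Ws] a
    by (intro absolutely_integrable_bounded_measurable_product_real)
      (auto intro!: continuous_imp_measurable_on_sets_lebesgue compact_imp_bounded compact_continuous_image)
  then have aWs: "(\<lambda>t. a t * Ws (b t) t) integrable_on {\<alpha>..\<beta>}"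
    by (auto simp: mult.commute dest: set_lebesgue_integral_eq_integral(1))
  have Wt_int: "(\<lambda>t. Wt (b t) t) integrable_on {\<alpha>..\<beta>}"
    using along[OF Wt] by (rule integrable_continuous_interval)
  have g_int: "?g integrable_on {\<alpha>..\<beta>}"
    using aWs Wt_int by (rule Henstock_Kurzweil_Integration.integrable_add)
  define F where "F t = W (b t) t - integral {\<alpha>..t} ?g" for t
  define K where "K = {0..b \<beta>} \<times> {\<alpha>..\<beta>}"
  have K: "compact K" "convex K"
    by (simp_all add: K_def compact_Times convex_Times)
  have "F \<beta> = F \<alpha>"
  proof (rule eq_if_increments_small[where F = F and \<alpha> = \<alpha> and \<beta> = \<beta> and m = "\<lambda>t. b t + t"])
    fix \<epsilon> :: real assume "\<epsilon> > 0"
    \<comment> \<open>Stated for a generic \<open>V\<close>, to be used for both partial derivatives.\<close>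
    have uc: "\<exists>\<delta>>0. \<forall>z\<in>K. \<forall>w\<in>K. dist w z < \<delta> \<longrightarrow> \<bar>V (fst w) (snd w) - V (fst z) (snd z)\<bar> < \<epsilon>"
      if V: "continuous_on UNIV (\<lambda>(s, t). V s t)" for V :: "real \<Rightarrow> real \<Rightarrow> real"
    proof -
      have "uniformly_continuous_on K (\<lambda>(s, t). V s t)"
        using continuous_on_subset[OF V] K(1) by (intro compact_uniformly_continuous) auto
      then show ?thesis
        unfolding uniformly_continuous_on_def dist_real_def case_prod_beta
        using \<open>\<epsilon> > 0\<close> by blast
    qed
    obtain \<delta>1 where \<delta>1: "\<delta>1 > 0" and uc1: "\<And>z w. z \<in> K \<Longrightarrow> w \<in> K \<Longrightarrow> dist w z < \<delta>1 \<Longrightarrow>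
        \<bar>Ws (fst w) (snd w) - Ws (fst z) (snd z)\<bar> < \<epsilon>"
      using uc[OF Ws] by blast
    obtain \<delta>2 where \<delta>2: "\<delta>2 > 0" and uc2: "\<And>z w. z \<in> K \<Longrightarrow> w \<in> K \<Longrightarrow> dist w z < \<delta>2 \<Longrightarrow>
        \<bar>Wt (fst w) (snd w) - Wt (fst z) (snd z)\<bar> < \<epsilon>"
      using uc[OF Wt] by blast
    define \<delta>' where "\<delta>' = min \<delta>1 \<delta>2 / 2"
    have \<delta>': "\<delta>' > 0" using \<delta>1 \<delta>2 by (simp add: \<delta>'_def)
    have "uniformly_continuous_on {\<alpha>..\<beta>} b"
      using b_cont by (intro compact_uniformly_continuous) auto
    then obtain \<delta>3 where \<delta>3: "\<delta>3 > 0" and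
        uc3: "\<And>p q. p \<in> {\<alpha>..\<beta>} \<Longrightarrow> q \<in> {\<alpha>..\<beta>} \<Longrightarrow> dist q p < \<delta>3 \<Longrightarrow> dist (b q) (b p) < \<delta>'"
      unfolding uniformly_continuous_on_def using \<delta>' by meson
    show "\<exists>\<delta>>0. \<forall>p q. \<alpha> \<le> p \<longrightarrow> p \<le> q \<longrightarrow> q \<le> \<beta> \<longrightarrow> q - p < \<delta> \<longrightarrow>
        \<bar>F q - F p\<bar> \<le> \<epsilon> * (b q + q - (b p + p))"
    proof (intro exI[of _ "min \<delta>3 \<delta>'"] conjI allI impI)
      show "min \<delta>3 \<delta>' > 0" using \<delta>3 \<delta>' by simp
      fix p q assume pq: "\<alpha> \<le> p" "p \<le> q" "q \<le> \<beta>" "q - p < min \<delta>3 \<delta>'"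
      have bpq: "b p \<le> b q" "0 \<le> b p" "b q \<le> b \<beta>" "b q - b p < \<delta>'"
        using b_mono[of p q] b_mono[of \<alpha> p] b_mono[of q \<beta>] uc3[of p q] pq b0
        by (auto simp: dist_real_def)
      \<comment> \<open>All evaluation points lie in the rectangle \<open>[b p, b q] \<times> [p, q]\<close>, whose sides are shorter
        than \<open>\<delta>'\<close>; hence the factor two here and the division by two in \<open>\<delta>'\<close>.\<close>
      have near: "dist (s', t') (s, t) < 2 * \<delta>'"
        if "s \<in> {b p..b q}" "s' \<in> {b p..b q}" "t \<in> {p..q}" "t' \<in> {p..q}" for s s' t t'
      proof -
        have "dist (s', t') (s, t) \<le> \<bar>s' - s\<bar> + \<bar>t' - t\<bar>"
          unfolding dist_prod_def dist_real_def using sqrt_sum_squares_le_sum_abs[of "s' - s" "t' - t"] by simp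
        also have "\<dots> < 2 * \<delta>'"
          using that bpq pq by (auto simp: abs_if)
        finally show ?thesis .
      qed
      have inK: "(s, t) \<in> K" if "s \<in> {b p..b q}" "t \<in> {p..q}" for s t
        using that bpq pq by (auto simp: K_def)
      have osc: "\<bar>Ws s' t' - Ws s t\<bar> < \<epsilon>" "\<bar>Wt s' t' - Wt s t\<bar> < \<epsilon>"
        if "s \<in> {b p..b q}" "s' \<in> {b p..b q}" "t \<in> {p..q}" "t' \<in> {p..q}" for s s' t t'
        using uc1[of "(s, t)" "(s', t')"] uc2[of "(s, t)" "(s', t')"] near[OF that] inK that
        by (auto simp: \<delta>'_def)
      \<comment> \<open>\<open>a\<close> may vanish almost everywhere on \<open>[p, q]\<close>, in which case \<open>b p = b q\<close>.\<close>
      obtain \<sigma> where \<sigma>: "\<sigma> \<in> {b p..b q}" "W (b q) q - W (b p) q = Ws \<sigma> q * (b q - b p)"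
      proof (cases "b p = b q")
        case True
        then show ?thesis using that[of "b p"] by simp
      next
        case False
        with bpq have less: "b p < b q" by simp
        obtain z where "z \<in> {b p<..<b q}" "W (b q) q - W (b p) q = Ws z q * (b q - b p)"
        proof (rule mvt[OF less, of "\<lambda>s. W s q" "\<lambda>s h. Ws s q * h"])
          show "continuous_on {b p..b q} (\<lambda>s. W s q)"
            using W continuous_on_subset by blast
          show "((\<lambda>s. W s q) has_derivative (\<lambda>h. Ws s q * h)) (at s)" if "b p < s" "s < b q" for s
            using ds[of s q] that bpq by (simp add: has_field_derivative_def)
        qed (metis greaterThanLessThan_iff)
        then show ?thesis using that[of z] by simp
      qed
      obtain \<theta> where \<theta>: "\<theta> \<in> {p..q}" "W (b p) q - W (b p) p = Wt (b p) \<theta> * (q - p)"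
      proof (cases "p = q")
        case False
        then obtain z where "p < z" "z < q" "W (b p) q - W (b p) p = (q - p) * Wt (b p) z"
          using MVT2[of p q "\<lambda>t. W (b p) t" "\<lambda>t. Wt (b p) t"] dt pq by auto
        then show ?thesis using that[of z] by (simp add: mult.commute)
      qed (use that[of p] in simp)
      have g_sub: "?g integrable_on {p..q}"
        using g_int by (rule integrable_on_subinterval) (use pq in auto)
      let ?lin = "\<lambda>t. a t * Ws \<sigma> q + Wt (b p) \<theta>"
      have lin: "(?lin has_integral (b q - b p) * Ws \<sigma> q + (q - p) * Wt (b p) \<theta>) {p..q}"
        unfolding b_diff[OF pq(1-3)] using a_sub[of p q] pq
        by (intro has_integral_add has_integral_mult_left integrable_integral)
          (use has_integral_const_real[of "Wt (b p) \<theta>" p q] in auto)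
      have maj: "((\<lambda>t. a t * \<epsilon> + \<epsilon>) has_integral (b q - b p) * \<epsilon> + (q - p) * \<epsilon>) {p..q}"
        unfolding b_diff[OF pq(1-3)] using a_sub[of p q] pq
        by (intro has_integral_add has_integral_mult_left integrable_integral)
          (use has_integral_const_real[of \<epsilon> p q] in auto)
      have "\<bar>integral {p..q} ?g - ((b q - b p) * Ws \<sigma> q + (q - p) * Wt (b p) \<theta>)\<bar>
          = norm (integral {p..q} (\<lambda>t. ?g t - ?lin t))"
        using Henstock_Kurzweil_Integration.integral_diff[OF g_sub has_integral_integrable[OF lin]]
          integral_unique[OF lin] by simp
      also have "\<dots> \<le> integral {p..q} (\<lambda>t. a t * \<epsilon> + \<epsilon>)"
      proof (rule Henstock_Kurzweil_Integration.integral_norm_bound_integral)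
        show "(\<lambda>t. ?g t - ?lin t) integrable_on {p..q}"
          using g_sub has_integral_integrable[OF lin] by (rule Henstock_Kurzweil_Integration.integrable_diff)
        show "(\<lambda>t. a t * \<epsilon> + \<epsilon>) integrable_on {p..q}"
          using maj by blast
        fix t assume t: "t \<in> {p..q}"
        have bt: "b t \<in> {b p..b q}"
          using b_mono[of p t] b_mono[of t q] t pq by auto
        have "norm (?g t - ?lin t) = \<bar>a t * (Ws (b t) t - Ws \<sigma> q) + (Wt (b t) t - Wt (b p) \<theta>)\<bar>"
          by (simp add: algebra_simps)
        also have "\<dots> \<le> \<bar>a t * (Ws (b t) t - Ws \<sigma> q)\<bar> + \<bar>Wt (b t) t - Wt (b p) \<theta>\<bar>"
          by (rule abs_triangle_ineq)
        also have "\<dots> \<le> a t * \<epsilon> + \<epsilon>"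
          using osc(1)[of \<sigma> "b t" q t] osc(2)[of "b p" "b t" \<theta> t] bt t \<sigma> \<theta> bpq pq nonneg[of t]
          by (intro add_mono) (auto simp: abs_mult intro!: mult_left_mono)
        finally show "norm (?g t - ?lin t) \<le> a t * \<epsilon> + \<epsilon>" .
      qed
      also have "\<dots> = \<epsilon> * (b q + q - (b p + p))"
        using integral_unique[OF maj] by (simp add: algebra_simps)
      finally have est: "\<bar>integral {p..q} ?g - ((b q - b p) * Ws \<sigma> q + (q - p) * Wt (b p) \<theta>)\<bar>
          \<le> \<epsilon> * (b q + q - (b p + p))" .
      have "integral {\<alpha>..q} ?g = integral {\<alpha>..p} ?g + integral {p..q} ?g"
        using integrable_on_subinterval[OF g_int, of \<alpha> q] pq
        by (intro Henstock_Kurzweil_Integration.integral_combine[symmetric]) auto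
      then have "F q - F p = (W (b q) q - W (b p) q) + (W (b p) q - W (b p) p) - integral {p..q} ?g"
        by (simp add: F_def)
      also have "\<dots> = (b q - b p) * Ws \<sigma> q + (q - p) * Wt (b p) \<theta> - integral {p..q} ?g"
        unfolding \<sigma>(2) \<theta>(2) by (simp add: mult.commute)
      finally show "\<bar>F q - F p\<bar> \<le> \<epsilon> * (b q + q - (b p + p))"
        using est by (simp add: abs_minus_commute)
    qed
  qed (rule \<open>\<alpha> \<le> \<beta>\<close>)
  then have "integral {\<alpha>..\<beta>} ?g = W (b \<beta>) \<beta> - W 0 \<alpha>"
    by (simp add: F_def b0)
  with integrable_integral[OF g_int] show ?thesis by simp
qed

section \<open>The heat kernel inverts the adjoint operator on test functions\<close>

lemma integral_heat_kernel_le_1: "(\<integral>z. heat_kernel (z - \<xi> :: real ^ 'n) s \<partial>lborel) \<le> 1"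
  using lborel_integral_translate[of "\<lambda>z :: real ^ 'n. heat_kernel z s" "- \<xi>"] integral_heat_kernel[of s, where 'n='n]
  by (cases "s > 0") (simp_all add: heat_kernel_def[of _ s])

text \<open>Each time slice of the kernel has mass at most one, so a bound \<open>m(t)\<close> on the slices of \<open>g\<close> makes
  the product integrable in space and time. The lemma serves twice: with \<open>c = \<xi>\<close> and \<open>g\<close> the adjoint
  operator applied to a test function, and with \<open>c = x\<close> and \<open>g = f\<close>.\<close>
lemma heat_kernel_slices:
  fixes c :: "real ^ 'n" and g :: "(real ^ 'n) \<times> real \<Rightarrow> real"
  assumes [measurable]: "s \<in> borel_measurable borel" "g \<in> borel_measurable borel"
    and bound: "\<And>x t. \<bar>g (x, t)\<bar> \<le> m t" and m: "integrable lborel m"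
  shows "integrable lborel (\<lambda>(x, t). heat_kernel (x - c) (s t) * g (x, t))"
    and "(\<integral>p. (case p of (x, t) \<Rightarrow> heat_kernel (x - c) (s t) * g (x, t)) \<partial>lborel)
        = (\<integral>t. (\<integral>x. heat_kernel (x - c) (s t) * g (x, t) \<partial>lborel) \<partial>lborel)"
    and "integrable lborel (\<lambda>t. \<integral>x. heat_kernel (x - c) (s t) * g (x, t) \<partial>lborel)"
    and "(\<integral>p. \<bar>case p of (x, t) \<Rightarrow> heat_kernel (x - c) (s t) * g (x, t)\<bar> \<partial>lborel) \<le> (\<integral>t. m t \<partial>lborel)"
proof -
  let ?k = "\<lambda>x t. heat_kernel (x - c) (s t) * g (x, t)"
  have [measurable]: "g \<in> borel_measurable (borel \<Otimes>\<^sub>M borel)"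
    by (simp add: borel_prod)
  have [measurable]: "case_prod ?k \<in> borel_measurable (lborel \<Otimes>\<^sub>M lborel)"
      "(\<lambda>(t, x). ?k x t) \<in> borel_measurable (lborel \<Otimes>\<^sub>M lborel)"
    by measurable
  have int_x: "integrable lborel (\<lambda>x. ?k x t)" for t
    by (rule integrable_heat_kernel_mult[OF _ bound]) measurable
  have slice: "(\<integral>x. \<bar>?k x t\<bar> \<partial>lborel) \<le> m t" for t
  proof -
    have "(\<integral>x. \<bar>?k x t\<bar> \<partial>lborel) \<le> (\<integral>x. m t * heat_kernel (x - c) (s t) \<partial>lborel)"
    proof (rule integral_mono)
      show "integrable lborel (\<lambda>x. \<bar>?k x t\<bar>)"
        using int_x by simp
      show "integrable lborel (\<lambda>x. m t * heat_kernel (x - c) (s t))"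
        using integrable_heat_kernel_mult[of "\<lambda>_. 1" 1 c "s t"] by auto
      show "\<bar>?k x t\<bar> \<le> m t * heat_kernel (x - c) (s t)" for x
        using bound by (simp add: abs_mult heat_kernel_nonneg mult.commute[of "heat_kernel _ _"] mult_right_mono)
    qed
    also have "\<dots> \<le> m t * 1"
      unfolding integral_mult_right_zero
      using bound[of undefined t] by (intro mult_left_mono integral_heat_kernel_le_1) linarith
    finally show ?thesis by simp
  qed
  have abs_int: "integrable lborel (\<lambda>t. \<integral>x. \<bar>?k x t\<bar> \<partial>lborel)"
  proof (rule Bochner_Integration.integrable_bound[OF m])
    show "AE t in lborel. norm (\<integral>x. \<bar>?k x t\<bar> \<partial>lborel) \<le> norm (m t)"
    proof (rule AE_I2)
      fix t
      have "0 \<le> (\<integral>x. \<bar>?k x t\<bar> \<partial>lborel)" by simp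
      with slice[of t] show "norm (\<integral>x. \<bar>?k x t\<bar> \<partial>lborel) \<le> norm (m t)"
        unfolding real_norm_def by linarith
    qed
  qed measurable
  have "integrable (lborel \<Otimes>\<^sub>M lborel) (\<lambda>(t, x). ?k x t)"
    by (rule lborel_pair.Fubini_integrable) (use abs_int int_x in auto)
  from lborel_pair.integrable_product_swap[OF this]
  have int: "integrable (lborel \<Otimes>\<^sub>M lborel) (case_prod ?k)"
    by (simp add: case_prod_beta)
  then show "integrable lborel (\<lambda>(x, t). ?k x t)"
    by (simp add: lborel_prod)
  show "(\<integral>p. (case p of (x, t) \<Rightarrow> ?k x t) \<partial>lborel) = (\<integral>t. (\<integral>x. ?k x t \<partial>lborel) \<partial>lborel)"
    using lborel_pair.integral_snd[OF int] by (simp add: lborel_prod)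
  show "integrable lborel (\<lambda>t. \<integral>x. ?k x t \<partial>lborel)"
    using lborel_pair.integrable_snd[OF int] .
  have "integrable (lborel \<Otimes>\<^sub>M lborel) (\<lambda>(x, t). \<bar>?k x t\<bar>)"
    using integrable_abs[OF int] by (simp add: split_beta')
  from lborel_pair.integral_snd[OF this]
  have "(\<integral>p. \<bar>case p of (x, t) \<Rightarrow> ?k x t\<bar> \<partial>lborel) = (\<integral>t. (\<integral>x. \<bar>?k x t\<bar> \<partial>lborel) \<partial>lborel)"
    by (simp add: lborel_prod split_beta')
  also have "\<dots> \<le> (\<integral>t. m t \<partial>lborel)"
    by (rule integral_mono[OF abs_int m slice])
  finally show "(\<integral>p. \<bar>case p of (x, t) \<Rightarrow> ?k x t\<bar> \<partial>lborel) \<le> (\<integral>t. m t \<partial>lborel)" .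
qed

lemma a1_eq_lborel:
  assumes [measurable]: "a \<in> borel_measurable borel"
  shows "a1 a t = (LINT z:{0..t}|lborel. a z)"
  unfolding a1_def set_lebesgue_integral_def by (rule integral_completion) measurable

lemma a1_eq_HK:
  assumes a: "integrable lborel a"
  shows "a1 a t = integral {0..t} a"
proof -
  have "set_integrable lborel {0..t} a"
    unfolding set_integrable_def using a by (intro integrable_mult_indicator) auto
  then show ?thesis
    using set_borel_integral_eq_integral(2) borel_measurable_integrable[OF a] by (simp add: a1_eq_lborel)
qed

lemma a1_diff:
  assumes a: "integrable lborel a" and "0 \<le> \<tau>" "\<tau> \<le> t"
  shows "a1 a t - a1 a \<tau> = integral {\<tau>..t} a"
proof -
  have "a integrable_on {0..t}"
    using integrable_on_lborel[OF a] integrable_on_subinterval by blast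
  from Henstock_Kurzweil_Integration.integral_combine[OF assms(2,3) this] show ?thesis
    by (simp add: a1_eq_HK[OF a])
qed

lemma a1_mono:
  assumes a: "integrable lborel a" and nonneg: "\<And>t. a t \<ge> 0"
  shows "mono (a1 a)"
proof (rule monoI)
  fix p q :: real assume "p \<le> q"
  have [measurable]: "a \<in> borel_measurable borel"
    using a by (simp add: borel_measurable_integrable)
  show "a1 a p \<le> a1 a q"
    unfolding a1_eq_lborel[OF \<open>a \<in> borel_measurable borel\<close>]
    using \<open>p \<le> q\<close> nonneg a unfolding set_lebesgue_integral_def
    by (intro integral_mono integrable_mult_indicator) (auto simp: indicator_def)
qed

lemma space_laplacian_test_function:
  fixes \<phi> :: "(real ^ 'n) \<times> real \<Rightarrow> real"
  assumes "test_function U \<phi>"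
  shows "continuous_on UNIV (space_laplacian \<phi>)" "\<exists>C\<ge>0. \<forall>p. \<bar>space_laplacian \<phi> p\<bar> \<le> C"
    "\<And>p. p \<notin> U \<Longrightarrow> space_laplacian \<phi> p = 0"
    "\<exists>K. compact K \<and> (\<forall>p. p \<notin> K \<longrightarrow> space_laplacian \<phi> p = 0)"
proof -
  let ?DD = "\<lambda>i. dderiv (axis i 1, 0) (dderiv (axis i 1, 0) \<phi>)"
  have tf: "test_function U (?DD i)" for i
    by (intro test_function_dderiv assms)
  show "continuous_on UNIV (space_laplacian \<phi>)"
    unfolding space_laplacian_def by (intro continuous_intros test_function_continuous[OF tf])
  have "\<exists>C\<ge>0. \<forall>p. \<bar>?DD i p\<bar> \<le> C" for i
    using test_function_bounded[OF tf] by metis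
  then obtain C where C: "\<And>i. C i \<ge> 0" "\<And>i p. \<bar>?DD i p\<bar> \<le> C i"
    by metis
  show "\<exists>C\<ge>0. \<forall>p. \<bar>space_laplacian \<phi> p\<bar> \<le> C"
    unfolding space_laplacian_def using C
    by (intro exI[of _ "\<Sum>i\<in>UNIV. C i"])
      (auto intro!: sum_nonneg order_trans[OF sum_abs] sum_mono)
  show "\<And>p. p \<notin> U \<Longrightarrow> space_laplacian \<phi> p = 0"
    unfolding space_laplacian_def by (simp add: test_function_eq_0[OF tf])
  have "\<exists>K. compact K \<and> (\<forall>p. p \<notin> K \<longrightarrow> ?DD i p = 0)" for i
    by (rule test_function_bounded_support[OF tf])
  then obtain K where "\<And>i. compact (K i)" "\<And>i p. p \<notin> K i \<Longrightarrow> ?DD i p = 0"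
    by metis
  then show "\<exists>K. compact K \<and> (\<forall>p. p \<notin> K \<longrightarrow> space_laplacian \<phi> p = 0)"
    unfolding space_laplacian_def by (intro exI[of _ "\<Union>i. K i"]) (auto intro!: compact_UN)
qed

text \<open>The formal adjoint of \<open>u \<mapsto> u\<^sub>t - a(t) \<Delta>u\<close>.\<close>
definition adjoint_heat :: "(real \<Rightarrow> real) \<Rightarrow> ((real ^ 'n) \<times> real \<Rightarrow> real) \<Rightarrow> (real ^ 'n) \<times> real \<Rightarrow> real" where
  "adjoint_heat a \<phi> p = - time_deriv \<phi> p - a (snd p) * space_laplacian \<phi> p"

lemma borel_measurable_adjoint_heat:
  fixes \<phi> :: "(real ^ 'n) \<times> real \<Rightarrow> real"
  assumes [measurable]: "a \<in> borel_measurable borel" and tf: "test_function U \<phi>"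
  shows "adjoint_heat a \<phi> \<in> borel_measurable borel"
proof -
  have "continuous_on UNIV (time_deriv \<phi>)"
    unfolding time_deriv_def by (intro test_function_continuous[OF test_function_dderiv[OF tf]])
  then have [measurable]: "time_deriv \<phi> \<in> borel_measurable (borel \<Otimes>\<^sub>M borel)"
      "space_laplacian \<phi> \<in> borel_measurable (borel \<Otimes>\<^sub>M borel)"
    using space_laplacian_test_function(1)[OF tf]
    by (auto simp: borel_prod intro: borel_measurable_continuous_onI)
  have "adjoint_heat a \<phi> \<in> borel_measurable (borel \<Otimes>\<^sub>M borel)"
    unfolding adjoint_heat_def[abs_def] by measurable
  then show ?thesis by (simp add: borel_prod)
qed

text \<open>The time argument \<open>b(t, \<tau>)\<close> of the kernel, extended by zero to the pairs that are not
  \<open>0 \<le> \<tau> \<le> t\<close>. As the heat kernel vanishes at time zero, this extension encodes the domain of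
  integration of the volume potential.\<close>
definition lag :: "(real \<Rightarrow> real) \<Rightarrow> real \<Rightarrow> real \<Rightarrow> real" where
  "lag a t \<tau> = (if 0 \<le> \<tau> \<and> \<tau> \<le> t then a1 a t - a1 a \<tau> else 0)"

lemma borel_measurable_lag [measurable (raw)]:
  assumes a: "integrable lborel a" "\<And>t. a t \<ge> 0"
    and [measurable]: "X \<in> borel_measurable M" "Y \<in> borel_measurable M"
  shows "(\<lambda>w. lag a (X w) (Y w)) \<in> borel_measurable M"
proof -
  have [measurable]: "a1 a \<in> borel_measurable borel"
    by (intro borel_measurable_mono a1_mono a)
  show ?thesis unfolding lag_def by measurable
qed

text \<open>The duality statement: the kernel issuing from \<open>(\<xi>, \<tau>)\<close> is a fundamental solution. The slice at
  time \<open>t > \<tau>\<close> is minus the integrand of the chain rule for \<open>W(b(t), t)\<close>, where \<open>W\<close> is the heat flow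
  of the test function. The flow starts at \<open>\<phi>(\<xi>, \<tau>)\<close> and ends at zero, because \<open>\<phi>\<close> vanishes near
  time \<open>T\<close>.\<close>
lemma integral_heat_kernel_adjoint_heat:
  fixes \<phi> :: "(real ^ 'n) \<times> real \<Rightarrow> real"
  assumes a: "integrable lborel a" "\<And>t. a t \<ge> 0"
    and incr: "\<And>p q. 0 \<le> p \<Longrightarrow> p < q \<Longrightarrow> q \<le> T \<Longrightarrow> a1 a p < a1 a q"
    and tf: "test_function (\<Omega> \<times> {0<..<T}) \<phi>"
    and \<tau>: "\<tau> \<in> {0..T}"
  shows "(\<integral>p. (case p of (x, t) \<Rightarrow> heat_kernel (x - \<xi>) (lag a t \<tau>) * adjoint_heat a \<phi> (x, t)) \<partial>lborel) = \<phi> (\<xi>, \<tau>)"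
proof -
  let ?t = "time_deriv \<phi>" and ?L = "space_laplacian \<phi>"
  have [measurable]: "a \<in> borel_measurable borel"
    using a(1) by (simp add: borel_measurable_integrable)
  have tf_t: "test_function (\<Omega> \<times> {0<..<T}) ?t"
    unfolding time_deriv_def by (rule test_function_dderiv[OF tf])
  obtain C1 where C1: "\<And>p. \<bar>?t p\<bar> \<le> C1"
    using test_function_bounded[OF tf_t] by metis
  obtain C2 where C2: "\<And>p. \<bar>?L p\<bar> \<le> C2"
    using space_laplacian_test_function(2)[OF tf] by blast
  obtain C3 where C3: "\<And>p. \<bar>\<phi> p\<bar> \<le> C3"
    using test_function_bounded[OF tf] by metis
  note cont = test_function_continuous[OF tf_t] space_laplacian_test_function(1)[OF tf] test_function_continuous[OF tf]
  have [measurable]: "?t \<in> borel_measurable borel" "?L \<in> borel_measurable borel"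
    using cont by (auto intro: borel_measurable_continuous_onI)
  have [measurable]: "?t \<in> borel_measurable (borel \<Otimes>\<^sub>M borel)" "?L \<in> borel_measurable (borel \<Otimes>\<^sub>M borel)"
    by (simp_all add: borel_prod)
  have adj_meas [measurable]: "adjoint_heat a \<phi> \<in> borel_measurable borel"
    by (rule borel_measurable_adjoint_heat[OF _ tf]) measurable
  have zero: "adjoint_heat a \<phi> (x, t) = 0" if "t \<notin> {0<..<T}" for x t
    using that test_function_eq_0[OF tf_t, of "(x, t)"] space_laplacian_test_function(3)[OF tf, of "(x, t)"]
    by (auto simp: adjoint_heat_def)
  define m where "m t = indicator {0..T} t * (C1 + a t * C2)" for t
  have m_bound: "\<bar>adjoint_heat a \<phi> (x, t)\<bar> \<le> m t" for x t
  proof (cases "t \<in> {0<..<T}")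
    case True
    have "\<bar>adjoint_heat a \<phi> (x, t)\<bar> \<le> \<bar>?t (x, t)\<bar> + \<bar>a t * ?L (x, t)\<bar>"
      by (simp add: adjoint_heat_def)
    also have "\<dots> \<le> C1 + a t * C2"
      using C1 C2 a(2) by (auto simp: abs_mult intro!: add_mono mult_left_mono)
    finally show ?thesis using True by (simp add: m_def)
  next
    case False
    have "0 \<le> C1" "0 \<le> C2" using C1[of undefined] C2[of undefined] by linarith+
    then show ?thesis using zero[OF False] a(2)[of t] by (simp add: m_def)
  qed
  have m_int: "integrable lborel m"
  proof -
    have "integrable lborel (\<lambda>t. indicator {0..T} t * C1 + indicator {0..T} t *\<^sub>R (a t * C2))"
      using a(1) by (intro Bochner_Integration.integrable_add integrable_mult_left integrable_mult_indicator
          integrable_real_indicator) (auto simp: emeasure_lborel_Icc_eq)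
    then show ?thesis by (simp add: m_def[abs_def] algebra_simps)
  qed
  have lag_meas: "(\<lambda>t. lag a t \<tau>) \<in> borel_measurable borel"
    using a by measurable
  note slices = heat_kernel_slices[OF lag_meas adj_meas m_bound m_int, of \<xi>]
  let ?b = "\<lambda>t. integral {\<tau>..t} a"
  let ?g = "\<lambda>t. a t * gaussian_average ?L \<xi> (?b t) t + gaussian_average ?t \<xi> (?b t) t"
  let ?S = "\<lambda>t. \<integral>x. heat_kernel (x - \<xi>) (lag a t \<tau>) * adjoint_heat a \<phi> (x, t) \<partial>lborel"
  \<comment> \<open>At \<open>t = \<tau>\<close> the kernel is zero by convention, but a single time is negligible.\<close>
  have slice: "?S t = (if t \<in> {\<tau>..T} then - ?g t else 0)" if "t \<noteq> \<tau>" for t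
  proof (cases "t \<in> {\<tau><..T}")
    case True
    then have lag: "lag a t \<tau> = ?b t" "?b t > 0"
      using \<tau> a1_diff[OF a(1), of \<tau> t] incr[of \<tau> t] by (auto simp: lag_def)
    have "?S t = (\<integral>z. heat_kernel z 1 * adjoint_heat a \<phi> (\<xi> + sqrt (?b t) *\<^sub>R z, t) \<partial>lborel)"
      unfolding lag(1) by (rule integral_heat_kernel_rescale[OF _ lag(2)]) measurable
    also have "\<dots> = (\<integral>z. - (heat_kernel z 1 * ?t (\<xi> + sqrt (?b t) *\<^sub>R z, t))
        - a t * (heat_kernel z 1 * ?L (\<xi> + sqrt (?b t) *\<^sub>R z, t)) \<partial>lborel)"
      by (simp add: adjoint_heat_def algebra_simps)
    also have "\<dots> = - ?g t"
    proof -
      have "integrable lborel (\<lambda>z. heat_kernel z 1 * ?t (\<xi> + sqrt (?b t) *\<^sub>R z, t))"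
        by (rule integrable_heat_kernel_mult[where \<xi> = 0, simplified, OF _ C1]) measurable
      moreover have "integrable lborel (\<lambda>z. heat_kernel z 1 * ?L (\<xi> + sqrt (?b t) *\<^sub>R z, t))"
        by (rule integrable_heat_kernel_mult[where \<xi> = 0, simplified, OF _ C2]) measurable
      ultimately show ?thesis by (simp add: gaussian_average_def)
    qed
    finally show ?thesis using True by simp
  next
    case False
    then have "t < \<tau> \<or> t > T" using that by auto
    then show ?thesis
    proof
      assume "t < \<tau>"
      then show ?thesis by (simp add: lag_def heat_kernel_def)
    next
      assume "t > T"
      then show ?thesis by (simp add: zero)
    qed
  qed
  have main: "(?g has_integral (gaussian_average \<phi> \<xi> (?b T) T - gaussian_average \<phi> \<xi> 0 \<tau>)) {\<tau>..T}"
  proof (rule has_integral_chain_rule_indefinite_integral)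
    show "\<tau> \<le> T" using \<tau> by simp
    have "set_integrable lborel {\<tau>..T} a"
      unfolding set_integrable_def using a(1) by (intro integrable_mult_indicator) auto
    then show "a absolutely_integrable_on {\<tau>..T}"
      by (simp add: set_integrable_def integrable_completion)
    show "continuous_on UNIV (\<lambda>(s, t). gaussian_average ?L \<xi> s t)"
      by (rule continuous_on_gaussian_average[OF cont(2) C2])
    show "continuous_on UNIV (\<lambda>(s, t). gaussian_average ?t \<xi> s t)"
      by (rule continuous_on_gaussian_average[OF cont(1) C1])
    show "continuous_on UNIV (\<lambda>s. gaussian_average \<phi> \<xi> s t)" for t
      using continuous_on_compose2[OF continuous_on_gaussian_average[OF cont(3) C3, of \<xi>]
          continuous_on_Pair[OF continuous_on_id continuous_on_const[where c = t]], of UNIV] by simp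
  qed (auto intro: a gaussian_average_has_scale_derivative[OF tf] gaussian_average_has_time_derivative[OF tf])
  have vanish: "gaussian_average \<phi> \<xi> (?b T) T = 0"
    unfolding gaussian_average_def by (simp add: test_function_eq_0[OF tf])
  have "((\<lambda>t. - ?g t) has_integral \<phi> (\<xi>, \<tau>)) {\<tau>..T}"
    using has_integral_neg[OF main] unfolding vanish gaussian_average_0 by (simp only: diff_0 minus_minus)
  then have "((\<lambda>t. if t \<in> {\<tau>..T} then - ?g t else 0) has_integral \<phi> (\<xi>, \<tau>)) UNIV"
    by (simp only: has_integral_restrict_UNIV)
  then have "(?S has_integral \<phi> (\<xi>, \<tau>)) UNIV"
    by (rule has_integral_spike[of "{\<tau>}", rotated 2]) (use slice in auto)
  then have "(\<integral>t. ?S t \<partial>lborel) = \<phi> (\<xi>, \<tau>)"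
    using has_integral_integral_lborel[OF slices(3)] has_integral_unique by blast
  then show ?thesis
    using slices(2) by simp
qed

section \<open>The volume potential of Borel data\<close>

lemma integrable_lborel_Times:
  fixes g :: "real \<Rightarrow> real" and B :: "'a::euclidean_space set"
  assumes B: "compact B" and g: "integrable lborel g"
  shows "integrable lborel (\<lambda>p. indicator B (fst p) * g (snd p))"
proof -
  have [measurable]: "B \<in> sets borel" "g \<in> borel_measurable borel"
    using B g by (auto simp: borel_compact borel_measurable_integrable)
  have "emeasure lborel B < \<infinity>"
    by (rule emeasure_compact_finite[OF B])
  then have iB: "integrable lborel (indicator B :: 'a \<Rightarrow> real)"
    by (simp add: integrable_real_indicator)
  have "integrable (lborel \<Otimes>\<^sub>M lborel) (\<lambda>p :: 'a \<times> real. indicator B (fst p) * g (snd p))"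
    by (rule lborel_pair.Fubini_integrable) (use iB g in \<open>auto simp: abs_mult intro!: AE_I2\<close>)
  then show ?thesis by (simp add: lborel_prod)
qed

lemma integrable_continuous_compact_support:
  fixes h :: "'a::euclidean_space \<Rightarrow> real"
  assumes "continuous_on UNIV h" "compact K" "\<And>p. p \<notin> K \<Longrightarrow> h p = 0"
  shows "integrable lborel h"
proof -
  have "(\<lambda>p. indicator K p *\<^sub>R h p) = h"
    using assms(3) by (intro ext) (auto simp: indicator_def)
  then show ?thesis
    using borel_integrable_compact[OF assms(2), of h] continuous_on_subset[OF assms(1)] by simp
qed

lemma integrable_adjoint_heat:
  fixes \<phi> :: "(real ^ 'n) \<times> real \<Rightarrow> real"
  assumes a: "integrable lborel a" and tf: "test_function U \<phi>"
  shows "integrable lborel (adjoint_heat a \<phi>)"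
proof -
  have tf_t: "test_function U (time_deriv \<phi>)"
    unfolding time_deriv_def by (rule test_function_dderiv[OF tf])
  have am [measurable]: "a \<in> borel_measurable borel"
    using a by (simp add: borel_measurable_integrable)
  have i1: "integrable lborel (time_deriv \<phi>)"
    using test_function_bounded_support[OF tf_t] test_function_continuous[OF tf_t]
      integrable_continuous_compact_support by metis
  obtain K where K: "compact K" "\<And>p. p \<notin> K \<Longrightarrow> space_laplacian \<phi> p = 0"
    using space_laplacian_test_function(4)[OF tf] by blast
  obtain C where C: "C \<ge> 0" "\<And>p. \<bar>space_laplacian \<phi> p\<bar> \<le> C"
    using space_laplacian_test_function(2)[OF tf] by blast
  have "compact (fst ` K)"
    using K(1) by (intro compact_continuous_image continuous_intros)
  then have dom: "integrable lborel (\<lambda>p. indicator (fst ` K) (fst p) * (C * a (snd p)))"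
    using integrable_mult_right[OF a, of C] by (rule integrable_lborel_Times)
  have [measurable]: "space_laplacian \<phi> \<in> borel_measurable (borel \<Otimes>\<^sub>M borel)"
    using space_laplacian_test_function(1)[OF tf]
    by (auto simp: borel_prod intro: borel_measurable_continuous_onI)
  have "(\<lambda>p. a (snd p) * space_laplacian \<phi> p) \<in> borel_measurable (borel \<Otimes>\<^sub>M borel)"
    by measurable
  then have meas: "(\<lambda>p. a (snd p) * space_laplacian \<phi> p) \<in> borel_measurable lborel"
    by (simp add: borel_prod)
  have i2: "integrable lborel (\<lambda>p. a (snd p) * space_laplacian \<phi> p)"
  proof (rule Bochner_Integration.integrable_bound[OF dom meas], rule AE_I2)
    fix p
    show "norm (a (snd p) * space_laplacian \<phi> p) \<le> norm (indicator (fst ` K) (fst p) * (C * a (snd p)))"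
    proof (cases "p \<in> K")
      case True
      then show ?thesis
        using C mult_right_mono[OF C(2)[of p], of "\<bar>a (snd p)\<bar>"] by (simp add: abs_mult mult.commute)
    qed (simp add: K(2))
  qed
  have "integrable lborel (\<lambda>p. - time_deriv \<phi> p - a (snd p) * space_laplacian \<phi> p)"
    using i1 i2 by (intro Bochner_Integration.integrable_diff integrable_minus)
  then show ?thesis by (simp add: adjoint_heat_def[abs_def])
qed

text \<open>The volume potential as one integral over space-time, which is the form needed for Fubini. The
  kernel is written with \<open>\<xi> - x\<close> instead of \<open>x - \<xi>\<close>, so that \<open>heat_kernel_slices\<close> applies.\<close>
definition potential ::
    "(real \<Rightarrow> real) \<Rightarrow> ((real ^ 'n) \<times> real \<Rightarrow> real) \<Rightarrow> (real ^ 'n) \<times> real \<Rightarrow> real" where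
  "potential a f p = (\<integral>q. (case q of (\<xi>, \<tau>) \<Rightarrow>
     heat_kernel (\<xi> - fst p) (lag a (snd p) \<tau>) * f (\<xi>, \<tau>)) \<partial>lborel)"

context
  fixes a :: "real \<Rightarrow> real" and f :: "(real ^ 'n) \<times> real \<Rightarrow> real" and M T :: real
  assumes a: "integrable lborel a" "\<And>t. a t \<ge> 0"
    and f: "f \<in> borel_measurable borel" and f_bound: "\<And>\<xi> \<tau>. \<bar>f (\<xi>, \<tau>)\<bar> \<le> M * indicator {0..T} \<tau>"
    and M: "M \<ge> 0" and T: "T \<ge> 0"
begin

lemma integrable_time_bound: "integrable lborel (\<lambda>\<tau>. M * indicator {0..T} \<tau>)"
  by (intro integrable_mult_right integrable_real_indicator) (auto simp: emeasure_lborel_Icc_eq)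

lemma lag_measurable: "lag a t \<in> borel_measurable borel"
  by (rule borel_measurable_lag[OF a]) simp_all

lemmas potential_slices = heat_kernel_slices[OF lag_measurable f f_bound integrable_time_bound]

lemma potential_abs_le: "(\<integral>q. \<bar>case q of (\<xi>, \<tau>) \<Rightarrow> heat_kernel (\<xi> - x) (lag a t \<tau>) * f (\<xi>, \<tau>)\<bar> \<partial>lborel) \<le> M * T"
  using potential_slices(4)[of x t] T by simp

lemma potential_bound: "\<bar>potential a f p\<bar> \<le> M * T"
proof -
  have "\<bar>potential a f p\<bar> \<le> (\<integral>q. \<bar>case q of (\<xi>, \<tau>) \<Rightarrow>
      heat_kernel (\<xi> - fst p) (lag a (snd p) \<tau>) * f (\<xi>, \<tau>)\<bar> \<partial>lborel)"
    unfolding potential_def by (rule integral_abs_bound)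
  also have "\<dots> \<le> M * T" by (rule potential_abs_le)
  finally show ?thesis .
qed

lemma borel_measurable_potential_kernel:
  "(\<lambda>(p, q). case q of (\<xi>, \<tau>) \<Rightarrow> heat_kernel (\<xi> - fst p) (lag a (snd p) \<tau>) * f (\<xi>, \<tau>))
    \<in> borel_measurable (lborel \<Otimes>\<^sub>M lborel)"
proof -
  have [measurable]: "f \<in> borel_measurable (borel \<Otimes>\<^sub>M borel)"
    using f by (simp add: borel_prod)
  note [measurable] = borel_measurable_lag[OF a]
  have "(\<lambda>(p, q). case q of (\<xi>, \<tau>) \<Rightarrow> heat_kernel (\<xi> - fst p) (lag a (snd p) \<tau>) * f (\<xi>, \<tau>))
    \<in> borel_measurable ((borel \<Otimes>\<^sub>M borel) \<Otimes>\<^sub>M (borel \<Otimes>\<^sub>M borel))"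
    by measurable
  then show ?thesis
    by (subst measurable_cong_sets[OF sets_pair_measure_cong[OF sets_lborel sets_lborel] refl])
      (simp add: borel_prod)
qed

lemma borel_measurable_potential: "potential a f \<in> borel_measurable borel"
proof -
  have "potential a f \<in> borel_measurable lborel"
    unfolding potential_def[abs_def]
    by (rule lborel.borel_measurable_lebesgue_integral) (rule borel_measurable_potential_kernel)
  then show ?thesis by simp
qed

text \<open>The weak form of the equation: Fubini exchanges the two space-time integrals, and the inner one
  is then given by the duality statement. Absolute integrability holds since the kernel integral of
  \<open>\<bar>f\<bar>\<close> is at most \<open>M T\<close>.\<close>
lemma integral_potential_adjoint_heat:
  assumes incr: "\<And>p q. 0 \<le> p \<Longrightarrow> p < q \<Longrightarrow> q \<le> T \<Longrightarrow> a1 a p < a1 a q"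
    and tf: "test_function (\<Omega> \<times> {0<..<T}) \<phi>"
  shows "(\<integral>p. potential a f p * adjoint_heat a \<phi> p \<partial>lborel) = (\<integral>q. f q * \<phi> q \<partial>lborel)"
proof -
  let ?k = "\<lambda>p q. case q of (\<xi>, \<tau>) \<Rightarrow> heat_kernel (\<xi> - fst p) (lag a (snd p) \<tau>) * f (\<xi>, \<tau>)"
  let ?F = "\<lambda>p q. ?k p q * adjoint_heat a \<phi> p"
  have a_meas: "a \<in> borel_measurable borel"
    using a(1) by (simp add: borel_measurable_integrable)
  have adj: "adjoint_heat a \<phi> \<in> borel_measurable lborel"
    using borel_measurable_adjoint_heat[OF a_meas tf] by simp
  have F_meas: "case_prod ?F \<in> borel_measurable (lborel \<Otimes>\<^sub>M lborel)"
    using borel_measurable_times[OF borel_measurable_potential_kernel measurable_compose[OF measurable_fst adj]]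
    by (simp add: split_beta')
  have k_int: "integrable lborel (?k p)" for p
    by (rule potential_slices(1))
  have "integrable (lborel \<Otimes>\<^sub>M lborel) (case_prod ?F)"
  proof (rule lborel_pair.Fubini_integrable[OF F_meas])
    show "AE p in lborel. integrable lborel (\<lambda>q. case_prod ?F (p, q))"
      using k_int by (intro AE_I2) simp
    have eq: "(\<integral>q. norm (case_prod ?F (p, q)) \<partial>lborel) = \<bar>adjoint_heat a \<phi> p\<bar> * (\<integral>q. \<bar>?k p q\<bar> \<partial>lborel)" for p
      by (simp add: abs_mult mult.commute)
    show "integrable lborel (\<lambda>p. \<integral>q. norm (case_prod ?F (p, q)) \<partial>lborel)"
    proof (rule Bochner_Integration.integrable_bound)
      show "integrable lborel (\<lambda>p. (M * T) * adjoint_heat a \<phi> p)"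
        by (intro integrable_mult_right integrable_adjoint_heat[OF a(1) tf])
      show "(\<lambda>p. \<integral>q. norm (case_prod ?F (p, q)) \<partial>lborel) \<in> borel_measurable lborel"
        using F_meas by (intro lborel.borel_measurable_lebesgue_integral borel_measurable_norm) (simp add: split_beta')
      show "AE p in lborel. norm (\<integral>q. norm (case_prod ?F (p, q)) \<partial>lborel) \<le> norm (M * T * adjoint_heat a \<phi> p)"
      proof (rule AE_I2)
        fix p :: "(real ^ 'n) \<times> real"
        have "(\<integral>q. \<bar>?k p q\<bar> \<partial>lborel) * \<bar>adjoint_heat a \<phi> p\<bar> \<le> M * T * \<bar>adjoint_heat a \<phi> p\<bar>"
          by (intro mult_right_mono potential_abs_le) simp
        then show "norm (\<integral>q. norm (case_prod ?F (p, q)) \<partial>lborel) \<le> norm (M * T * adjoint_heat a \<phi> p)"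
          unfolding eq using M T by (simp add: abs_mult mult.commute)
      qed
    qed
  qed
  note Fub = lborel_pair.Fubini_integral[OF this]
  have "(\<integral>p. potential a f p * adjoint_heat a \<phi> p \<partial>lborel) = (\<integral>p. (\<integral>q. ?F p q \<partial>lborel) \<partial>lborel)"
    by (simp add: potential_def)
  also have "\<dots> = (\<integral>q. (\<integral>p. ?F p q \<partial>lborel) \<partial>lborel)"
    by (rule Fub[symmetric])
  also have "\<dots> = (\<integral>q. f q * \<phi> q \<partial>lborel)"
  proof (rule Bochner_Integration.integral_cong[OF refl])
    fix q :: "(real ^ 'n) \<times> real"
    obtain \<xi> \<tau> where q: "q = (\<xi>, \<tau>)" by (cases q)
    have "(\<integral>p. ?F p q \<partial>lborel) = (\<integral>p. f q * (case p of (x, t) \<Rightarrow>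
        heat_kernel (x - \<xi>) (lag a t \<tau>) * adjoint_heat a \<phi> (x, t)) \<partial>lborel)"
      by (rule Bochner_Integration.integral_cong)
        (auto simp: q heat_kernel_def norm_minus_commute)
    also have "\<dots> = f q * (\<integral>p. (case p of (x, t) \<Rightarrow>
        heat_kernel (x - \<xi>) (lag a t \<tau>) * adjoint_heat a \<phi> (x, t)) \<partial>lborel)"
      by simp
    also have "\<dots> = f q * \<phi> q"
    proof (cases "\<tau> \<in> {0..T}")
      case True
      then show ?thesis
        by (simp add: q integral_heat_kernel_adjoint_heat[OF a incr tf])
    next
      case False
      then have "f q = 0" using f_bound[of \<xi> \<tau>] by (simp add: q)
      then show ?thesis by simp
    qed
    finally show "(\<integral>p. ?F p q \<partial>lborel) = f q * \<phi> q" .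
  qed
  finally show ?thesis .
qed

end

section \<open>From Lebesgue measurable to Borel data\<close>

text \<open>Completeness of Lebesgue measure makes \<open>F\<close> measurable as soon as it agrees almost everywhere with
  a Borel function.\<close>
lemma lebesgue_AE_eq_borel:
  fixes F G :: "'a::euclidean_space \<Rightarrow> real"
  assumes ae: "AE x in lborel. F x = G x" and G: "G \<in> borel_measurable borel"
  shows integral_lebesgue_AE_eq: "integral\<^sup>L lebesgue F = integral\<^sup>L lborel G"
    and integrable_lebesgue_AE_eq: "integrable lebesgue F \<longleftrightarrow> integrable lborel G"
proof -
  have G': "G \<in> borel_measurable lborel" "G \<in> borel_measurable lebesgue"
    using G by (auto intro: measurable_completion)
  have ae': "AE x in lebesgue. F x = G x"
    using ae by (rule AE_completion)
  have F: "F \<in> borel_measurable lebesgue"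
  proof (rule measurableI)
    fix A :: "real set" assume A: "A \<in> sets borel"
    show "F -` A \<inter> space lebesgue \<in> sets lebesgue"
    proof (rule completion.in_sets_AE)
      show "AE x in lebesgue. x \<in> G -` A \<inter> space lebesgue \<longleftrightarrow> x \<in> F -` A \<inter> space lebesgue"
        using ae' by eventually_elim auto
      show "G -` A \<inter> space lebesgue \<in> sets lebesgue"
        using G'(2) A by (rule measurable_sets)
    qed simp
  qed simp
  show "integral\<^sup>L lebesgue F = integral\<^sup>L lborel G"
    using integral_cong_AE[OF F G'(2) ae'] integral_completion[OF G'(1)] by simp
  show "integrable lebesgue F \<longleftrightarrow> integrable lborel G"
    using integrable_cong_AE[OF F G'(2) ae'] integrable_completion[OF G'(1)] by simp
qed

text \<open>The exceptional set need not be Borel, so it is enlarged to a Borel null set before Fubini's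
  theorem for null sets is used.\<close>
lemma AE_lborel_slices:
  fixes P :: "'a::euclidean_space \<times> 'b::euclidean_space \<Rightarrow> bool"
  assumes "AE p in lborel. P p"
  shows "AE y in lborel. AE x in lborel. P (x, y)"
proof -
  obtain N where N: "{p \<in> space lborel. \<not> P p} \<subseteq> N" "emeasure lborel N = 0" "N \<in> sets lborel"
    using assms by (rule AE_E)
  have N': "N \<in> sets (lborel \<Otimes>\<^sub>M lborel)"
    using N(3) unfolding lborel_prod .
  have "AE p in lborel \<Otimes>\<^sub>M lborel. p \<notin> N"
    unfolding lborel_prod using N by (intro AE_not_in) (auto simp: null_sets_def)
  then have "AE x in lborel. AE y in lborel. (x, y) \<notin> N"
    by (rule lborel_pair.AE_pair)
  moreover have "{p \<in> space (lborel \<Otimes>\<^sub>M lborel). (fst p, snd p) \<notin> N} \<in> sets (lborel \<Otimes>\<^sub>M lborel)"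
    using sets.compl_sets[OF N'] by (simp add: set_diff_eq)
  ultimately have "AE y in lborel. AE x in lborel. (x, y) \<notin> N"
    using lborel_pair.AE_commute[of "\<lambda>x y. (x, y) \<notin> N"] by simp
  then show ?thesis
    using N(1) by (auto elim!: eventually_mono)
qed

lemma AE_lborel_snd:
  fixes P :: "'b::euclidean_space \<Rightarrow> bool"
  assumes "AE y in lborel. P y"
  shows "AE p in lborel. P (snd (p :: 'a::euclidean_space \<times> 'b))"
proof -
  obtain N where N: "{p \<in> space lborel. \<not> P p} \<subseteq> N" "emeasure lborel N = 0" "N \<in> sets lborel"
    using assms by (rule AE_E)
  have "emeasure (lborel \<Otimes>\<^sub>M lborel) ((UNIV :: 'a set) \<times> N) = 0"
    using N(2,3) by (subst lborel.emeasure_pair_measure_Times) auto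
  moreover have "(UNIV :: 'a set) \<times> N \<in> sets (lborel \<Otimes>\<^sub>M lborel)"
    using N(3) by (intro pair_measureI) auto
  ultimately have "(UNIV :: 'a set) \<times> N \<in> null_sets lborel"
    unfolding lborel_prod null_sets_def by simp
  from AE_not_in[OF this] show ?thesis
    using N(1) by (auto elim!: eventually_mono)
qed

text \<open>Each isolated point is singled out by a member of a countable basis.\<close>
lemma countable_isolated_points:
  fixes S :: "'a::euclidean_space set"
  assumes "\<And>x. x \<in> S \<Longrightarrow> x isolated_in S"
  shows "countable S"
proof -
  obtain B :: "'a set set" where B: "countable B" "topological_basis B"
    using ex_countable_basis by blast
  have "\<exists>b\<in>B. b \<inter> S = {x}" if x: "x \<in> S" for x
  proof -
    obtain U where "open U" "U \<inter> S = {x}"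
      using assms[OF x] by (auto simp: isolated_in_def)
    moreover then obtain b where "b \<in> B" "x \<in> b" "b \<subseteq> U"
      using topological_basisE[OF B(2), of U x] by blast
    ultimately show ?thesis using x by blast
  qed
  then obtain g where g: "\<And>x. x \<in> S \<Longrightarrow> g x \<in> B \<and> g x \<inter> S = {x}"
    by metis
  then have "inj_on g S"
    by (metis inj_onI singleton_inject)
  moreover have "countable (g ` S)"
    using g by (intro countable_subset[OF _ B(1)]) auto
  ultimately show ?thesis
    by (rule countable_image_inj_on[rotated])
qed

text \<open>Absolute values go under both integrals, where \<open>\<bar>f\<bar>\<close> is replaced by its bound \<open>M\<close>. Both steps are
  valid even if a slice of \<open>f\<close> is not measurable, because the integral of a function that is not
  integrable is zero and the majorant is integrable and nonnegative.\<close>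
lemma volume_potential_abs_le:
  fixes \<Omega> :: "(real ^ 'n) set"
  assumes t: "t \<ge> 0" and M: "\<And>p. p \<in> \<Omega> \<times> {0..t} \<Longrightarrow> \<bar>f p\<bar> \<le> M" "M \<ge> 0"
  shows "\<bar>volume_potential \<Omega> a f (x, t)\<bar> \<le> t * M"
proof -
  have inner: "\<bar>LINT \<xi>:\<Omega>|lebesgue. heat_kernel (x - \<xi>) s * f (\<xi>, \<tau>)\<bar> \<le> M"
    if \<tau>: "\<tau> \<in> {0..t}" for s \<tau>
  proof -
    let ?F = "\<lambda>\<xi>. indicator \<Omega> \<xi> *\<^sub>R (heat_kernel (x - \<xi>) s * f (\<xi>, \<tau>))"
    have sym: "heat_kernel (x - \<xi>) s = heat_kernel (\<xi> - x) s" for \<xi>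
      by (simp add: heat_kernel_def norm_minus_commute)
    have int: "integrable lborel (\<lambda>\<xi>. heat_kernel (\<xi> - x) s * M)"
      by (rule integrable_heat_kernel_mult[of _ M]) (use M(2) in auto)
    have "\<bar>integral\<^sup>L lebesgue ?F\<bar> \<le> (\<integral>\<xi>. \<bar>?F \<xi>\<bar> \<partial>lebesgue)"
      by (rule integral_abs_bound)
    also have "\<dots> \<le> (\<integral>\<xi>. heat_kernel (\<xi> - x) s * M \<partial>lebesgue)"
    proof (rule integral_mono')
      show "integrable lebesgue (\<lambda>\<xi>. heat_kernel (\<xi> - x) s * M)"
        using int by (subst integrable_completion) (auto simp: borel_measurable_integrable)
      show "\<bar>?F \<xi>\<bar> \<le> heat_kernel (\<xi> - x) s * M" for \<xi>
        using M(1)[of "(\<xi>, \<tau>)"] M(2) \<tau>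
        by (auto simp: indicator_def abs_mult heat_kernel_nonneg sym intro!: mult_left_mono)
    qed (use M(2) in \<open>simp add: heat_kernel_nonneg\<close>)
    also have "\<dots> = (\<integral>\<xi>. heat_kernel (\<xi> - x) s \<partial>lborel) * M"
      using int by (subst integral_completion) (auto simp: borel_measurable_integrable)
    also have "\<dots> \<le> 1 * M"
      by (intro mult_right_mono integral_heat_kernel_le_1 M(2))
    finally show ?thesis by (simp add: set_lebesgue_integral_def)
  qed
  let ?I = "\<lambda>\<tau>. LINT \<xi>:\<Omega>|lebesgue. heat_kernel (x - \<xi>) (a1 a t - a1 a \<tau>) * f (\<xi>, \<tau>)"
  have "\<bar>\<integral>\<tau>. indicator {0..t} \<tau> *\<^sub>R ?I \<tau> \<partial>lebesgue\<bar> \<le> (\<integral>\<tau>. \<bar>indicator {0..t} \<tau> *\<^sub>R ?I \<tau>\<bar> \<partial>lebesgue)"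
    by (rule integral_abs_bound)
  also have "\<dots> \<le> (\<integral>\<tau>. indicator {0..t} \<tau> * M \<partial>lebesgue)"
  proof (rule integral_mono')
    show "integrable lebesgue (\<lambda>\<tau>. indicator {0..t} \<tau> * M)"
      by (intro integrable_mult_left integrable_real_indicator) (auto simp: emeasure_lborel_Icc_eq)
    show "\<bar>indicator {0..t} \<tau> *\<^sub>R ?I \<tau>\<bar> \<le> indicator {0..t} \<tau> * M" for \<tau>
      using inner[of \<tau>] by (simp add: indicator_def)
  qed (use M(2) in simp)
  also have "\<dots> = t * M"
    using t by simp
  finally show ?thesis
    by (simp add: volume_potential_def set_lebesgue_integral_def)
qed

text \<open>For almost every \<open>\<tau>\<close> the slice of \<open>f\<close> at \<open>\<tau>\<close> agrees almost everywhere with the slice of its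
  representative, so the iterated Lebesgue integrals agree at every point \<open>(x, t)\<close>, not just at
  almost every one.\<close>
lemma volume_potential_eq_potential:
  fixes \<Omega> :: "(real ^ 'n) set"
  assumes a: "integrable lborel a'" "\<And>t. a' t \<ge> 0"
    and a1_eq: "\<And>t. t \<le> T \<Longrightarrow> a1 a t = a1 a' t"
    and f: "f' \<in> borel_measurable borel" and f_bound: "\<And>\<xi> \<tau>. \<bar>f' (\<xi>, \<tau>)\<bar> \<le> M * indicator {0..T} \<tau>"
    and M: "M \<ge> 0" and T: "T \<ge> 0"
    and ae: "AE p in lborel. indicator (\<Omega> \<times> {0..T}) p * f p = f' p"
    and t: "t \<in> {0..T}"
  shows "volume_potential \<Omega> a f (x, t) = potential a' f' (x, t)"
proof -
  let ?I = "\<lambda>\<tau>. LINT \<xi>:\<Omega>|lebesgue. heat_kernel (x - \<xi>) (a1 a t - a1 a \<tau>) * f (\<xi>, \<tau>)"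
  let ?J = "\<lambda>\<tau>. \<integral>\<xi>. heat_kernel (\<xi> - x) (lag a' t \<tau>) * f' (\<xi>, \<tau>) \<partial>lborel"
  note slices = potential_slices[OF a f f_bound M T]
  have "AE \<tau> in lborel. indicator {0..t} \<tau> *\<^sub>R ?I \<tau> = ?J \<tau>"
    using AE_lborel_slices[OF ae]
  proof eventually_elim
    case (elim \<tau>)
    show ?case
    proof (cases "\<tau> \<in> {0..t}")
      case True
      with t have \<tau>: "0 \<le> \<tau>" "\<tau> \<le> t" "\<tau> \<le> T" "t \<le> T" by auto
      then have lag: "a1 a t - a1 a \<tau> = lag a' t \<tau>"
        by (simp add: lag_def a1_eq)
      have "?I \<tau> = ?J \<tau>"
        unfolding set_lebesgue_integral_def
      proof (rule integral_lebesgue_AE_eq)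
        show "AE \<xi> in lborel. indicator \<Omega> \<xi> *\<^sub>R (heat_kernel (x - \<xi>) (a1 a t - a1 a \<tau>) * f (\<xi>, \<tau>))
            = heat_kernel (\<xi> - x) (lag a' t \<tau>) * f' (\<xi>, \<tau>)"
          using elim
        proof eventually_elim
          case (elim \<xi>)
          then show ?case
            using \<tau> unfolding lag elim[symmetric]
            by (simp add: indicator_def heat_kernel_def norm_minus_commute)
        qed
        have [measurable]: "f' \<in> borel_measurable (borel \<Otimes>\<^sub>M borel)"
          using f by (simp add: borel_prod)
        show "(\<lambda>\<xi>. heat_kernel (\<xi> - x) (lag a' t \<tau>) * f' (\<xi>, \<tau>)) \<in> borel_measurable borel"
          by measurable
      qed
      with True show ?thesis by simp
    next
      case False
      then have "lag a' t \<tau> = 0" by (auto simp: lag_def)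
      then show ?thesis using False by (simp add: heat_kernel_def)
    qed
  qed
  then have "(\<integral>\<tau>. indicator {0..t} \<tau> *\<^sub>R ?I \<tau> \<partial>lebesgue) = (\<integral>\<tau>. ?J \<tau> \<partial>lborel)"
    by (rule integral_lebesgue_AE_eq) (use borel_measurable_integrable[OF slices(3)[of x t]] in simp)
  then show ?thesis
    using slices(2)[of x t] by (simp add: volume_potential_def potential_def set_lebesgue_integral_def)
qed

text \<open>Truncation makes the bound hold everywhere and not only outside a null set.\<close>
lemma borel_representative_bounded:
  fixes f :: "'a::euclidean_space \<Rightarrow> real"
  assumes S: "S \<in> sets borel" and f: "f \<in> borel_measurable (lebesgue_on S)"
    and bound: "\<And>p. p \<in> S \<Longrightarrow> \<bar>f p\<bar> \<le> M" and M: "M \<ge> 0"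
  obtains f' where "f' \<in> borel_measurable borel" "\<And>p. \<bar>f' p\<bar> \<le> M * indicator S p"
    "AE p in lborel. indicator S p * f p = f' p"
proof -
  have "(\<lambda>p. indicator S p * f p) \<in> borel_measurable lebesgue"
    using f S by (subst (asm) borel_measurable_restrict_space_iff) (auto simp: mult.commute)
  from completion_ex_borel_measurable_real[OF this]
  obtain f0 where f0: "f0 \<in> borel_measurable lborel" "AE p in lborel. indicator S p * f p = f0 p"
    by blast
  have [measurable]: "f0 \<in> borel_measurable borel" "S \<in> sets borel"
    using f0 S by auto
  show ?thesis
  proof
    show "(\<lambda>p. indicator S p * max (- M) (min M (f0 p))) \<in> borel_measurable borel"
      by measurable
    show "\<bar>indicator S p * max (- M) (min M (f0 p))\<bar> \<le> M * indicator S p" for p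
      using M by (auto simp: indicator_def)
    show "AE p in lborel. indicator S p * f p = indicator S p * max (- M) (min M (f0 p))"
      using f0(2)
    proof eventually_elim
      case (elim p)
      then show ?case
        using bound[of p] by (cases "p \<in> S") auto
    qed
  qed
qed

lemma borel_representative_coefficient:
  fixes a :: "real \<Rightarrow> real"
  assumes a: "set_integrable lebesgue {0..T} a" and nonneg: "\<And>t. t \<in> {0..T} \<Longrightarrow> a t \<ge> 0"
  obtains a' where "integrable lborel a'" "\<And>t. a' t \<ge> 0"
    "AE t in lborel. indicator {0..T} t * a t = a' t"
proof -
  have "(\<lambda>t. indicator {0..T} t * a t) \<in> borel_measurable lebesgue"
    using a by (auto simp: set_integrable_def dest: borel_measurable_integrable)
  from completion_ex_borel_measurable_real[OF this]
  obtain a0 where a0: "a0 \<in> borel_measurable lborel" "AE t in lborel. indicator {0..T} t * a t = a0 t"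
    by blast
  have ae: "AE t in lborel. indicator {0..T} t * a t = max 0 (a0 t)"
    using a0(2)
  proof eventually_elim
    case (elim t)
    then show ?case using nonneg[of t] by (cases "t \<in> {0..T}") auto
  qed
  have "integrable lborel (\<lambda>t. max 0 (a0 t))"
    using integrable_lebesgue_AE_eq[OF ae] a a0(1) by (simp add: set_integrable_def)
  with ae show ?thesis by (intro that[of "\<lambda>t. max 0 (a0 t)"]) auto
qed

lemma a1_representative:
  assumes ae: "AE z in lborel. indicator {0..T} z * a z = a' z" and a': "integrable lborel a'"
    and t: "t \<le> T"
  shows "a1 a t = a1 a' t"
proof -
  have meas [measurable]: "a' \<in> borel_measurable borel"
    using a' by (simp add: borel_measurable_integrable)
  have "AE z in lborel. indicator {0..t} z *\<^sub>R a z = indicator {0..t} z *\<^sub>R a' z"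
    using ae
  proof eventually_elim
    case (elim z)
    then show ?case using t by (auto simp: indicator_def split: if_splits)
  qed
  then have "(\<integral>z. indicator {0..t} z *\<^sub>R a z \<partial>lebesgue) = (\<integral>z. indicator {0..t} z *\<^sub>R a' z \<partial>lborel)"
    by (rule integral_lebesgue_AE_eq) measurable
  then show ?thesis
    unfolding a1_eq_lborel[OF meas] a1_def[of a] set_lebesgue_integral_def .
qed

text \<open>The set of zeros of \<open>a\<close> is countable, hence null, so the integral of \<open>a\<close> over an interval of
  positive length cannot vanish.\<close>
lemma a1_strictly_increasing:
  assumes ae: "AE z in lborel. indicator {0..T} z * a z = a' z" and a': "integrable lborel a'" "\<And>t. a' t \<ge> 0"
    and isolated: "\<And>t. t \<in> {0..T} \<Longrightarrow> a t = 0 \<Longrightarrow> t isolated_in {s \<in> {0..T}. a s = 0}"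
    and pq: "0 \<le> p" "p < q" "q \<le> T"
  shows "a1 a' p < a1 a' q"
proof (rule ccontr)
  let ?h = "\<lambda>z. indicator {p..q} z *\<^sub>R a' z"
  assume "\<not> a1 a' p < a1 a' q"
  then have "integral {p..q} a' \<le> 0"
    using a1_diff[OF a'(1), of p q] pq by simp
  moreover have int: "integrable lborel ?h"
    using a'(1) by (intro integrable_mult_indicator) auto
  moreover have "integral {p..q} a' = integral\<^sup>L lborel ?h"
    using set_borel_integral_eq_integral(2)[of "{p..q}" a'] int
    by (simp add: set_integrable_def set_lebesgue_integral_def)
  moreover have "0 \<le> integral\<^sup>L lborel ?h"
    using a'(2) by (intro Bochner_Integration.integral_nonneg) auto
  ultimately have "integral\<^sup>L lborel ?h = 0"
    by linarith
  then have "AE z in lborel. ?h z = 0"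
    using integral_nonneg_eq_0_iff_AE[OF int] a'(2) by simp
  moreover have "countable {s \<in> {0..T}. a s = 0}"
    using isolated by (intro countable_isolated_points) auto
  then have "AE z in lborel. z \<notin> {s \<in> {0..T}. a s = 0}"
    by (intro AE_not_in countable_imp_null_set_lborel)
  ultimately have "AE z in lborel. z \<notin> {p..q}"
    using ae
  proof eventually_elim
    case (elim z)
    then show ?case using pq by (auto simp: indicator_def)
  qed
  then have "{p..q} \<in> null_sets lborel"
    by (subst (asm) AE_iff_null_sets[symmetric]) auto
  then show False using pq by (simp add: null_sets_def)
qed

section \<open>The volume potential solves the degenerate heat equation\<close>

theorem theorem2p2:
  fixes \<Omega> :: "(real ^ 'n) set"
    and T l :: real
    and a :: "real \<Rightarrow> real"
    and f :: "(real ^ 'n) \<times> real \<Rightarrow> real"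
  assumes "CARD('n) \<ge> 2"
    and "0 < T"
    and "0 < l" and "l < 1"
    and "C1_holder_domain l \<Omega>"
    and "set_integrable lebesgue {0..T} a"
    and "\<And>t. t \<in> {0..T} \<Longrightarrow> a t \<ge> 0"
    and "\<And>t. t \<in> {0..T} \<Longrightarrow> a t = 0 \<Longrightarrow> t isolated_in {s \<in> {0..T}. a s = 0}"
    and "f \<in> borel_measurable (lebesgue_on (\<Omega> \<times> {0..T}))"
    and "bounded (f ` (\<Omega> \<times> {0..T}))"
    and "\<And>t. t \<in> {0..T} \<Longrightarrow> closure (support_on \<Omega> (\<lambda>x. f (x, t))) \<subseteq> \<Omega>"
  shows "(\<forall>x\<in>\<Omega>. \<forall>t\<in>{0<..<T}.
            \<bar>volume_potential \<Omega> a f (x, t)\<bar> \<le> t * (SUP p\<in>\<Omega> \<times> {0..t}. \<bar>f p\<bar>)) \<and>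
         solves_heat_equation \<Omega> T a f (volume_potential \<Omega> a f) \<and>
         uniform_limit \<Omega> (\<lambda>t x. volume_potential \<Omega> a f (x, t)) (\<lambda>x. 0) (at_right 0)"
proof (intro conjI ballI)
  have \<Omega>: "open \<Omega>"
    using assms(5) by (simp add: C1_holder_domain_def)
  obtain M where M: "M \<ge> 0" "\<And>p. p \<in> \<Omega> \<times> {0..T} \<Longrightarrow> \<bar>f p\<bar> \<le> M"
  proof -
    obtain M where "\<And>p. p \<in> \<Omega> \<times> {0..T} \<Longrightarrow> \<bar>f p\<bar> \<le> M"
      using assms(10) unfolding bounded_iff by auto
    then show ?thesis by (intro that[of "max M 0"]) (auto simp: le_max_iff_disj)
  qed
  show "\<bar>volume_potential \<Omega> a f (x, t)\<bar> \<le> t * (SUP p\<in>\<Omega> \<times> {0..t}. \<bar>f p\<bar>)"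
    if "x \<in> \<Omega>" "t \<in> {0<..<T}" for x t
  proof (rule volume_potential_abs_le)
    have bdd: "bdd_above ((\<lambda>p. \<bar>f p\<bar>) ` (\<Omega> \<times> {0..t}))"
      using that M(2) by (intro bdd_aboveI2[of _ _ M]) auto
    show le: "\<bar>f p\<bar> \<le> (SUP p\<in>\<Omega> \<times> {0..t}. \<bar>f p\<bar>)" if "p \<in> \<Omega> \<times> {0..t}" for p
      using that bdd by (rule cSUP_upper)
    show "0 \<le> (SUP p\<in>\<Omega> \<times> {0..t}. \<bar>f p\<bar>)"
      using le[of "(x, 0)"] that by (intro order_trans[OF abs_ge_zero[of "f (x, 0)"]]) auto
  qed (use that in auto)
  have V_le: "\<bar>volume_potential \<Omega> a f (x, t)\<bar> \<le> t * M" if "t \<in> {0..T}" for x t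
    using that M by (intro volume_potential_abs_le) auto
  show "uniform_limit \<Omega> (\<lambda>t x. volume_potential \<Omega> a f (x, t)) (\<lambda>x. 0) (at_right 0)"
  proof (rule uniform_limitI)
    fix e :: real assume e: "e > 0"
    have "((\<lambda>t. t * M) \<longlongrightarrow> 0 * M) (at_right 0)"
      by (intro tendsto_intros)
    then have "\<forall>\<^sub>F t in at_right 0. t * M < e"
      using e by (intro order_tendstoD(2)[of _ "0 * M"]) auto
    moreover have "\<forall>\<^sub>F t in at_right 0. t \<in> {0<..<T}"
      using \<open>0 < T\<close> by (rule eventually_at_right_real)
    ultimately show "\<forall>\<^sub>F t in at_right 0. \<forall>x\<in>\<Omega>. dist (volume_potential \<Omega> a f (x, t)) 0 < e"
    proof eventually_elim
      case (elim t)
      then show ?case using V_le[of t] by (auto intro: le_less_trans)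
    qed
  qed
  have S: "\<Omega> \<times> {0..T} \<in> sets borel"
    using \<Omega> unfolding borel_prod[symmetric] by (intro pair_measureI) auto
  obtain f' where f': "f' \<in> borel_measurable borel" "\<And>p. \<bar>f' p\<bar> \<le> M * indicator (\<Omega> \<times> {0..T}) p"
      "AE p in lborel. indicator (\<Omega> \<times> {0..T}) p * f p = f' p"
    using borel_representative_bounded[OF S assms(9) M(2,1)] by blast
  have f'_bound: "\<bar>f' (\<xi>, \<tau>)\<bar> \<le> M * indicator {0..T} \<tau>" for \<xi> \<tau>
    using f'(2)[of "(\<xi>, \<tau>)"] M(1)
    by (cases "\<xi> \<in> \<Omega>") (auto simp: indicator_def split: if_splits)
  have f'_bounded: "\<bar>f' p\<bar> \<le> M" for p
    using f'(2)[of p] M(1) by (cases "p \<in> \<Omega> \<times> {0..T}") auto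
  obtain a' where a': "integrable lborel a'" "\<And>t. a' t \<ge> 0"
      "AE t in lborel. indicator {0..T} t * a t = a' t"
    using borel_representative_coefficient[OF assms(6,7)] by blast
  have a'_meas [measurable]: "a' \<in> borel_measurable borel"
    using a'(1) by (simp add: borel_measurable_integrable)
  have T: "T \<ge> 0" using \<open>0 < T\<close> by simp
  let ?u = "volume_potential \<Omega> a f" and ?v = "potential a' f'"
  have uv: "?u (x, t) = ?v (x, t)" if "t \<in> {0..T}" for x t
    by (rule volume_potential_eq_potential[OF a'(1,2) a1_representative[OF a'(3,1)] f'(1) f'_bound M(1) T f'(3) that])
  have v_meas [measurable]: "?v \<in> borel_measurable borel"
    by (rule borel_measurable_potential[OF a'(1,2) f'(1) f'_bound M(1) T])
  have v_bound: "\<bar>?v p\<bar> \<le> M * T" for p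
    by (rule potential_bound[OF a'(1,2) f'(1) f'_bound M(1) T])
  have ae_a: "AE p in lborel. indicator {0..T} (snd p) * a (snd p) = a' (snd (p :: (real ^ 'n) \<times> real))"
    by (rule AE_lborel_snd[OF a'(3)])
  show "solves_heat_equation \<Omega> T a f ?u"
    unfolding solves_heat_equation_def
  proof (intro conjI allI impI)
    show "locally_integrable_on (\<Omega> \<times> {0<..<T}) ?u"
      unfolding locally_integrable_on_def set_integrable_def
    proof (intro allI impI, elim conjE)
      fix K assume K: "compact K" "K \<subseteq> \<Omega> \<times> {0<..<T}"
      have [measurable]: "K \<in> sets borel" using K(1) by (rule borel_compact)
      have "integrable lborel (\<lambda>p. indicator K p *\<^sub>R ?v p)"
      proof (rule Bochner_Integration.integrable_bound)
        show "integrable lborel (\<lambda>p. (M * T) * indicator K p :: real)"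
          using emeasure_compact_finite[OF K(1)]
          by (intro integrable_mult_right integrable_real_indicator) auto
        show "AE p in lborel. norm (indicator K p *\<^sub>R ?v p) \<le> norm ((M * T) * indicator K p)"
          using v_bound M T by (intro AE_I2) (auto simp: indicator_def intro: order_trans[OF _ abs_ge_self])
      qed simp
      moreover have "AE p in lborel. indicator K p *\<^sub>R ?u p = indicator K p *\<^sub>R ?v p"
        using K(2) uv by (intro AE_I2) (auto simp: indicator_def)
      ultimately show "integrable lebesgue (\<lambda>p. indicator K p *\<^sub>R ?u p)"
        by (subst integrable_lebesgue_AE_eq) auto
    qed
    show "locally_integrable_on (\<Omega> \<times> {0<..<T}) (\<lambda>(x, t). a t * ?u (x, t))"
      unfolding locally_integrable_on_def set_integrable_def
    proof (intro allI impI, elim conjE)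
      fix K assume K: "compact K" "K \<subseteq> \<Omega> \<times> {0<..<T}"
      have K_meas [measurable]: "K \<in> sets borel" using K(1) by (rule borel_compact)
      have "(\<lambda>p :: (real ^ 'n) \<times> real. a' (snd p)) \<in> borel_measurable (borel \<Otimes>\<^sub>M borel)"
        by measurable
      then have [measurable]: "(\<lambda>p :: (real ^ 'n) \<times> real. a' (snd p)) \<in> borel_measurable borel"
        unfolding borel_prod .
      have "integrable lborel (\<lambda>p. indicator K p *\<^sub>R (a' (snd p) * ?v p))"
      proof (rule Bochner_Integration.integrable_bound)
        have "compact (fst ` K)"
          using K(1) by (intro compact_continuous_image continuous_intros)
        then show "integrable lborel (\<lambda>p. indicator (fst ` K) (fst p) * ((M * T) * a' (snd p)))"
          using integrable_mult_right[OF a'(1), of "M * T"] by (rule integrable_lborel_Times)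
        show "AE p in lborel. norm (indicator K p *\<^sub>R (a' (snd p) * ?v p))
            \<le> norm (indicator (fst ` K) (fst p) * ((M * T) * a' (snd p)))"
        proof (rule AE_I2)
          fix p :: "(real ^ 'n) \<times> real"
          have "a' (snd p) * \<bar>?v p\<bar> \<le> a' (snd p) * (M * T)"
            using v_bound a'(2) by (rule mult_left_mono)
          then show "norm (indicator K p *\<^sub>R (a' (snd p) * ?v p))
              \<le> norm (indicator (fst ` K) (fst p) * ((M * T) * a' (snd p)))"
            using M T a'(2) by (cases "p \<in> K") (auto simp: abs_mult mult.commute)
        qed
      qed simp
      moreover have "AE p in lborel. indicator K p *\<^sub>R (case p of (x, t) \<Rightarrow> a t * ?u (x, t))
          = indicator K p *\<^sub>R (a' (snd p) * ?v p)"
        using ae_a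
      proof eventually_elim
        case (elim p)
        then show ?case using K(2) uv[of "snd p" "fst p"]
          by (cases "p \<in> K") (auto simp: indicator_def)
      qed
      ultimately show "integrable lebesgue (\<lambda>p. indicator K p *\<^sub>R (case p of (x, t) \<Rightarrow> a t * ?u (x, t)))"
        by (subst integrable_lebesgue_AE_eq) auto
    qed
    show "locally_integrable_on (\<Omega> \<times> {0<..<T}) f"
      unfolding locally_integrable_on_def set_integrable_def
    proof (intro allI impI, elim conjE)
      fix K assume K: "compact K" "K \<subseteq> \<Omega> \<times> {0<..<T}"
      have [measurable]: "K \<in> sets borel" using K(1) by (rule borel_compact)
      note f'(1) [measurable]
      have "integrable lborel (\<lambda>p. indicator K p *\<^sub>R f' p)"
      proof (rule Bochner_Integration.integrable_bound)
        show "integrable lborel (\<lambda>p. M * indicator K p :: real)"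
          using emeasure_compact_finite[OF K(1)]
          by (intro integrable_mult_right integrable_real_indicator) auto
        show "AE p in lborel. norm (indicator K p *\<^sub>R f' p) \<le> norm (M * indicator K p)"
          using f'_bounded M(1) by (intro AE_I2) (auto simp: indicator_def)
      qed simp
      moreover have "AE p in lborel. indicator K p *\<^sub>R f p = indicator K p *\<^sub>R f' p"
        using f'(3)
      proof eventually_elim
        case (elim p)
        then show ?case using K(2) by (cases "p \<in> K") (auto simp: indicator_def)
      qed
      ultimately show "integrable lebesgue (\<lambda>p. indicator K p *\<^sub>R f p)"
        by (subst integrable_lebesgue_AE_eq) auto
    qed
  next
    fix \<phi> :: "(real ^ 'n) \<times> real \<Rightarrow> real"
    assume tf: "test_function (\<Omega> \<times> {0<..<T}) \<phi>"
    have tf_t: "test_function (\<Omega> \<times> {0<..<T}) (time_deriv \<phi>)"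
      unfolding time_deriv_def by (rule test_function_dderiv[OF tf])
    note [measurable] = borel_measurable_adjoint_heat[OF a'_meas tf] f'(1)
      borel_measurable_continuous_onI[OF test_function_continuous[OF tf]]
    have "(LINT p:\<Omega> \<times> {0<..<T}|lebesgue.
            ?u p * (- time_deriv \<phi> p) - a (snd p) * ?u p * space_laplacian \<phi> p)
        = (\<integral>p. ?v p * adjoint_heat a' \<phi> p \<partial>lborel)"
      unfolding set_lebesgue_integral_def
    proof (rule integral_lebesgue_AE_eq)
      show "AE p in lborel. indicator (\<Omega> \<times> {0<..<T}) p *\<^sub>R
          (?u p * (- time_deriv \<phi> p) - a (snd p) * ?u p * space_laplacian \<phi> p)
          = ?v p * adjoint_heat a' \<phi> p"
        using ae_a
      proof eventually_elim
        case (elim p)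
        show ?case
        proof (cases "p \<in> \<Omega> \<times> {0<..<T}")
          case True
          then have "a (snd p) = a' (snd p)" "?u p = ?v p"
            using elim uv[of "snd p" "fst p"] by (auto simp: indicator_def)
          then show ?thesis using True by (simp add: adjoint_heat_def algebra_simps)
        next
          case False
          then show ?thesis
            using test_function_eq_0[OF tf_t False] space_laplacian_test_function(3)[OF tf False]
            by (simp add: adjoint_heat_def)
        qed
      qed
    qed measurable
    also have "\<dots> = (\<integral>q. f' q * \<phi> q \<partial>lborel)"
      by (rule integral_potential_adjoint_heat[OF a'(1,2) f'(1) f'_bound M(1) T
            a1_strictly_increasing[OF a'(3,1,2) assms(8)] tf])
    also have "\<dots> = (LINT p:\<Omega> \<times> {0<..<T}|lebesgue. f p * \<phi> p)"
      unfolding set_lebesgue_integral_def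
    proof (rule integral_lebesgue_AE_eq[symmetric])
      show "AE p in lborel. indicator (\<Omega> \<times> {0<..<T}) p *\<^sub>R (f p * \<phi> p) = f' p * \<phi> p"
        using f'(3)
      proof eventually_elim
        case (elim p)
        show ?case
        proof (cases "p \<in> \<Omega> \<times> {0<..<T}")
          case True
          then have "f p = f' p" using elim by (auto simp: indicator_def)
          then show ?thesis using True by simp
        qed (simp add: test_function_eq_0[OF tf])
      qed
    qed measurable
    finally show "(LINT p:\<Omega> \<times> {0<..<T}|lebesgue.
            ?u p * (- time_deriv \<phi> p) - a (snd p) * ?u p * space_laplacian \<phi> p)
        = (LINT p:\<Omega> \<times> {0<..<T}|lebesgue. f p * \<phi> p)" .
  qed
qed

end
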